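(* Let $f:\mathcal{X}^n\to\mathbb{R}$ be a query with sensitivity $\phi(f)$, let $b>0$, $\delta\in(0,1)$, and let $g(\boldsymbol X)=f(\boldsymbol X)+\xi$ with $\xi\sim\mathsf{Lap}(0,b)$ drawn independently of the database $\boldsymbol X\in\mathcal{X}^n$ (the Laplace mechanism). Let $Z\sim\mathcal{N}(0,2b^2\log(12/\delta))$ be independent of everything else. Then there is a mechanism $h$, constructible in time polynomial in $1/\delta$ purely from $g(\boldsymbol X)$ (i.e. $h$ is a randomized function of $g(\boldsymbol X)$ alone, without access to $f$ or $\boldsymbol X$), such that for each $\boldsymbol X\in\mathcal{X}^n$, $$\mathsf{d_{TV}}\big(h,\,f(\boldsymbol X)+Z\big)\le\delta.$$ In particular, the mechanism $h$ is $\big(\frac{\phi(f)}b,0\big)$ differentially private for $f$ with accuracy (at most) $$\sqrt{2b^2\log(12/\delta)+2b^2+\frac{b^2}4\,\delta\log^{3/2}(12/\delta)}.$$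
   Context: Databases $\boldsymbol X,\boldsymbol Y\in\mathcal{X}^n$ are neighbors if their Hamming distance is at most $1$. A randomized mechanism $g:\mathcal{X}^n\to\mathbb{R}$ is $(\epsilon,\delta)$ differentially private if $\mathbb{P}(g(\boldsymbol X)\in B)\le e^\epsilon\,\mathbb{P}(g(\boldsymbol Y)\in B)+\delta$ for all Borel $B\subseteq\mathbb{R}$ and all neighbors $\boldsymbol X,\boldsymbol Y$. The sensitivity is $\phi(f)=\max_{\boldsymbol X,\boldsymbol Y\text{ neighbors}}|f(\boldsymbol X)-f(\boldsymbol Y)|$ (assumed finite). The accuracy of a mechanism $g$ for $f$ is $\max_{\boldsymbol X}\sqrt{\mathbb{E}[(g(\boldsymbol X)-f(\boldsymbol X))^2]}$. $\mathsf{Lap}(0,b)$ has density $\frac1{2b}e^{-|x|/b}$. $\mathsf{d_{TV}}$ is the total variation distance between laws. Running time is in a real-arithmetic model where sampling from uniform and Gaussian distributions and evaluating elementary functions have unit cost. *)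

theory Defs
  imports
    "HOL-Probability.Probability"
    "HOL-Computational_Algebra.Polynomial"
begin

section \<open>Databases, queries and private mechanisms\<close>

text \<open>
  A mechanism is represented by the family of its output laws: \<open>g X\<close> is the law of the
  (random) answer on the database \<open>X\<close>.
\<close>

definition databases :: "'x set \<Rightarrow> nat \<Rightarrow> 'x list set" where
  "databases U n = {X. set X \<subseteq> U \<and> length X = n}"

definition hamming :: "'x list \<Rightarrow> 'x list \<Rightarrow> nat" where
  "hamming X Y = card {i. i < length X \<and> X ! i \<noteq> Y ! i}"

definition neighbors :: "'x set \<Rightarrow> nat \<Rightarrow> ('x list \<times> 'x list) set" where
  "neighbors U n = {(X, Y). X \<in> databases U n \<and> Y \<in> databases U n \<and> hamming X Y \<le> 1}"

definition finite_sensitivity :: "'x set \<Rightarrow> nat \<Rightarrow> ('x list \<Rightarrow> real) \<Rightarrow> bool" where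
  "finite_sensitivity U n f \<longleftrightarrow> bdd_above ((\<lambda>(X, Y). \<bar>f X - f Y\<bar>) ` neighbors U n)"

definition sensitivity :: "'x set \<Rightarrow> nat \<Rightarrow> ('x list \<Rightarrow> real) \<Rightarrow> real" where
  "sensitivity U n f = (SUP (X, Y)\<in>neighbors U n. \<bar>f X - f Y\<bar>)"

definition mechanism :: "'x set \<Rightarrow> nat \<Rightarrow> ('x list \<Rightarrow> real measure) \<Rightarrow> bool" where
  "mechanism U n g \<longleftrightarrow> (\<forall>X\<in>databases U n. prob_space (g X) \<and> sets (g X) = sets borel)"

definition differentially_private ::
    "'x set \<Rightarrow> nat \<Rightarrow> real \<Rightarrow> real \<Rightarrow> ('x list \<Rightarrow> real measure) \<Rightarrow> bool" where
  "differentially_private U n \<epsilon> \<delta> g \<longleftrightarrow>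
     mechanism U n g \<and>
     (\<forall>(X, Y)\<in>neighbors U n. \<forall>B\<in>sets borel.
        measure (g X) B \<le> exp \<epsilon> * measure (g Y) B + \<delta>)"

text \<open>Root mean square error; it is infinite if the squared error is not integrable.\<close>

definition rmse :: "real measure \<Rightarrow> real \<Rightarrow> ennreal" where
  "rmse M a =
     (if integrable M (\<lambda>v. (v - a)\<^sup>2) then ennreal (sqrt (LINT v|M. (v - a)\<^sup>2)) else \<infinity>)"

definition accuracy ::
    "'x set \<Rightarrow> nat \<Rightarrow> ('x list \<Rightarrow> real measure) \<Rightarrow> ('x list \<Rightarrow> real) \<Rightarrow> ennreal" where
  "accuracy U n g f = (SUP X\<in>databases U n. rmse (g X) (f X))"

definition total_variation :: "'a measure \<Rightarrow> 'a measure \<Rightarrow> real" where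
  "total_variation M N = (SUP B\<in>sets M. \<bar>measure M B - measure N B\<bar>)"

text \<open>\<open>gaussian v\<close> is the centred normal law with variance (not standard deviation) \<open>v\<close>.\<close>

definition gaussian :: "real \<Rightarrow> real measure" where
  "gaussian v = density lborel (normal_density 0 (sqrt v))"

definition laplace :: "real \<Rightarrow> real measure" where
  "laplace b = density lborel (\<lambda>x. ennreal (1 / (2 * b) * exp (- \<bar>x\<bar> / b)))"

text \<open>The law of the query answer perturbed by independent noise.\<close>

definition add_noise :: "('x list \<Rightarrow> real) \<Rightarrow> real measure \<Rightarrow> 'x list \<Rightarrow> real measure" where
  "add_noise f \<nu> X = distr \<nu> borel (\<lambda>\<xi>. f X + \<xi>)"


section \<open>Randomized programs over the reals\<close>

text \<open>
  A real-arithmetic machine: a program works on finitely many real registers, and each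
  arithmetic operation, evaluation of an elementary function, comparison and sampling
  step takes one unit of time. Only integer constants are built in. Arguments outside the
  domain of a partial operation follow the library's conventions for total functions.
\<close>

datatype expr =
    Reg nat
  | Const int
  | Add expr expr
  | Sub expr expr
  | Mul expr expr
  | Div expr expr
  | Sqrt expr
  | Exp expr
  | Ln expr
  | Sin expr
  | Cos expr
  | Arctan expr

primrec val :: "(nat \<Rightarrow> real) \<Rightarrow> expr \<Rightarrow> real" where
  "val s (Reg r) = s r"
| "val s (Const k) = real_of_int k"
| "val s (Add e e') = val s e + val s e'"
| "val s (Sub e e') = val s e - val s e'"
| "val s (Mul e e') = val s e * val s e'"
| "val s (Div e e') = val s e / val s e'"
| "val s (Sqrt e) = sqrt (val s e)"
| "val s (Exp e) = exp (val s e)"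
| "val s (Ln e) = ln (val s e)"
| "val s (Sin e) = sin (val s e)"
| "val s (Cos e) = cos (val s e)"
| "val s (Arctan e) = arctan (val s e)"

primrec cost :: "expr \<Rightarrow> nat" where
  "cost (Reg r) = 1"
| "cost (Const k) = 1"
| "cost (Add e e') = 1 + cost e + cost e'"
| "cost (Sub e e') = 1 + cost e + cost e'"
| "cost (Mul e e') = 1 + cost e + cost e'"
| "cost (Div e e') = 1 + cost e + cost e'"
| "cost (Sqrt e) = 1 + cost e"
| "cost (Exp e) = 1 + cost e"
| "cost (Ln e) = 1 + cost e"
| "cost (Sin e) = 1 + cost e"
| "cost (Cos e) = 1 + cost e"
| "cost (Arctan e) = 1 + cost e"

text \<open>
  \<open>IfLess e e' c c'\<close> runs \<open>c\<close> if \<open>e < e'\<close> and \<open>c'\<close> otherwise; \<open>WhileLess e e' c\<close> repeats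
  \<open>c\<close> as long as \<open>e < e'\<close>.
\<close>

datatype prog =
    Skip
  | Assign nat expr
  | SampleUniform nat
  | SampleNormal nat
  | Seq prog prog
  | IfLess expr expr prog prog
  | WhileLess expr expr prog

text \<open>
  A configuration consists of the registers and two infinite tapes which hold the values
  of the uniform and of the standard normal samples still to be drawn. Drawing a sample
  consumes the head of a tape; since the entries are independent, so are all samples.
\<close>

type_synonym config = "(nat \<Rightarrow> real) \<times> real stream \<times> real stream"

text \<open>\<open>exec P c t c'\<close>: started in \<open>c\<close>, the program \<open>P\<close> halts in \<open>c'\<close> after \<open>t\<close> time units.\<close>

inductive exec :: "prog \<Rightarrow> config \<Rightarrow> nat \<Rightarrow> config \<Rightarrow> bool" where
  Skip: "exec Skip c 1 c"
| Assign: "exec (Assign r e) (s, u, z) (1 + cost e) (s(r := val s e), u, z)"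
| SampleUniform: "exec (SampleUniform r) (s, u, z) 1 (s(r := shd u), stl u, z)"
| SampleNormal: "exec (SampleNormal r) (s, u, z) 1 (s(r := shd z), u, stl z)"
| Seq: "exec P c t c' \<Longrightarrow> exec Q c' t' c'' \<Longrightarrow> exec (Seq P Q) c (t + t') c''"
| IfTrue: "val (fst c) e < val (fst c) e' \<Longrightarrow> exec P c t c' \<Longrightarrow>
    exec (IfLess e e' P Q) c (1 + cost e + cost e' + t) c'"
| IfFalse: "\<not> val (fst c) e < val (fst c) e' \<Longrightarrow> exec Q c t c' \<Longrightarrow>
    exec (IfLess e e' P Q) c (1 + cost e + cost e' + t) c'"
| WhileFalse: "\<not> val (fst c) e < val (fst c) e' \<Longrightarrow>
    exec (WhileLess e e' P) c (1 + cost e + cost e') c"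
| WhileTrue: "val (fst c) e < val (fst c) e' \<Longrightarrow> exec P c t c' \<Longrightarrow>
    exec (WhileLess e e' P) c' t' c'' \<Longrightarrow>
    exec (WhileLess e e' P) c (1 + cost e + cost e' + t + t') c''"

lemma exec_deterministic:
  "exec P c t c' \<Longrightarrow> exec P c t1 c1 \<Longrightarrow> t1 = t \<and> c1 = c'"
proof (induction arbitrary: t1 c1 rule: exec.induct)
  case (Skip c)
  then show ?case by cases simp_all
next
  case (Assign r e s u z)
  then show ?case by cases simp_all
next
  case (SampleUniform r s u z)
  then show ?case by cases simp_all
next
  case (SampleNormal r s u z)
  then show ?case by cases simp_all
next
  case (Seq P c t c' Q t' c'')
  from Seq.prems obtain t2 c2 t3 where "exec P c t2 c2" "exec Q c2 t3 c1" "t1 = t2 + t3"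
    by cases simp_all
  with Seq.IH show ?case by blast
next
  case (IfTrue c e e' P t c' Q)
  from IfTrue.prems IfTrue.hyps obtain t2
    where "exec P c t2 c1" "t1 = 1 + cost e + cost e' + t2"
    by cases simp_all
  with IfTrue.IH show ?case by blast
next
  case (IfFalse c e e' Q t c' P)
  from IfFalse.prems IfFalse.hyps obtain t2
    where "exec Q c t2 c1" "t1 = 1 + cost e + cost e' + t2"
    by cases simp_all
  with IfFalse.IH show ?case by blast
next
  case (WhileFalse c e e' P)
  from WhileFalse.prems WhileFalse.hyps show ?case
    by cases simp_all
next
  case (WhileTrue c e e' P t c' t' c'')
  from WhileTrue.prems WhileTrue.hyps obtain t2 c2 t3
    where "exec P c t2 c2" "exec (WhileLess e e' P) c2 t3 c1"
      "t1 = 1 + cost e + cost e' + t2 + t3"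
    by cases simp_all
  with WhileTrue.IH show ?case by blast
qed

text \<open>
  The input list is stored in the registers \<open>0, 1, \<dots>\<close>, the other registers are initially
  zero; the result is the final content of register \<open>0\<close>.
\<close>

definition init :: "real list \<Rightarrow> nat \<Rightarrow> real" where
  "init xs r = (if r < length xs then xs ! r else 0)"

definition result :: "prog \<Rightarrow> real list \<Rightarrow> real stream \<times> real stream \<Rightarrow> real" where
  "result P xs \<omega> = (THE v. \<exists>t s \<omega>'. exec P (init xs, \<omega>) t (s, \<omega>') \<and> v = s 0)"

lemma result_eq: "exec P (init xs, \<omega>) t (s, \<omega>') \<Longrightarrow> result P xs \<omega> = s 0"
  unfolding result_def using exec_deterministic by (blast intro: the_equality)

text \<open>Worst case over the outcomes of all the random draws.\<close>

definition halts_within :: "prog \<Rightarrow> real list \<Rightarrow> real \<Rightarrow> bool" where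
  "halts_within P xs T \<longleftrightarrow>
     (\<forall>\<omega>. \<exists>t c. exec P (init xs, \<omega>) t c \<and> real t \<le> T)"

definition coins :: "(real stream \<times> real stream) measure" where
  "coins = stream_space (uniform_measure lborel {0..1}) \<Otimes>\<^sub>M stream_space std_normal_distribution"

lemma prob_space_coins: "prob_space coins"
proof -
  have "prob_space (uniform_measure lborel {0..1::real})"
    by (rule prob_space_uniform_measure) auto
  then have "prob_space (stream_space (uniform_measure lborel {0..1::real}))"
    by (rule prob_space.prob_space_stream_space)
  moreover have "prob_space std_normal_distribution"
    by (rule prob_space_normal_density) simp
  then have "prob_space (stream_space std_normal_distribution)"
    by (rule prob_space.prob_space_stream_space)
  ultimately show ?thesis
    unfolding coins_def by (rule prob_space_pair)
qed

text \<open>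
  The law of the result of \<open>P\<close> on the input \<open>y # ps\<close>, where \<open>y\<close> is drawn from \<open>M\<close>
  independently of the random draws of \<open>P\<close>, and \<open>ps\<close> is a list of fixed parameters.
\<close>

definition result_law :: "prog \<Rightarrow> real list \<Rightarrow> real measure \<Rightarrow> real measure" where
  "result_law P ps M = distr (M \<Otimes>\<^sub>M coins) borel (\<lambda>(y, \<omega>). result P (y # ps) \<omega>)"

end

theory Submission
  imports Defs "HOL-Real_Asymp.Real_Asymp"
begin

text \<open>
  The Laplace law inverts the operator \<open>u \<mapsto> u - b\<^sup>2 u''\<close>: if \<open>\<phi>\<close> is the density of the normal law
  of variance \<open>\<sigma>\<^sup>2 = 2 b\<^sup>2 L\<close>, \<open>L = ln (12 / \<delta>)\<close>, then adding Laplace noise to the signed density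
  \<open>\<phi> - b\<^sup>2 \<phi>''\<close> gives \<open>\<phi>\<close>. This signed density is a multiple of
  \<open>\<phi>(w) (1 - (w / \<sigma>)\<^sup>2 / c)\<close> with \<open>c = 2 L + 1\<close>, so its negative part lives on \<open>\<bar>w\<bar> > \<sigma> \<surd>c\<close> and
  has mass at most \<open>\<delta> / 12\<close>. The mechanism adds to \<open>g(X)\<close> a sample from the normalised
  positive part, obtained by rejection from the normal law: a standard normal proposal \<open>z\<close> is accepted
  with probability \<open>max 0 (1 - z\<^sup>2 / c)\<close>, hence rejected with probability at most \<open>1 / c \<le> 1 / 4\<close>,
  and \<open>\<lceil>1 / \<delta>\<rceil>\<close> rounds fail with probability at most \<open>\<delta> / 3\<close>.

  Privacy is inherited from the Laplace density since the added noise is independent of the data.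
  For the accuracy, the acceptance probability decreases in \<open>z\<^sup>2\<close>, so conditioning on acceptance
  does not increase the second moment and the mean square error is at most \<open>2 b\<^sup>2 + \<sigma>\<^sup>2\<close>.
\<close>

subsection \<open>The program\<close>

text \<open>The last accepted proposal wins; the loop has no early exit.\<close>

primrec rejection :: "nat \<Rightarrow> real \<Rightarrow> real \<Rightarrow> real stream \<Rightarrow> real stream \<Rightarrow> real" where
  "rejection 0 c w u z = w"
| "rejection (Suc n) c w u z =
     rejection n c (if shd u < 1 - (shd z)\<^sup>2 / c then shd z else w) (stl u) (stl z)"

text \<open>\<open>Reg 2\<close> holds \<delta>, so the value is 2 L = \<open>c - 1\<close>. Adding
  1 gives the constant \<open>c\<close> of the acceptance test, and the square root is \<sigma> /
  b.\<close>

definition log_expr :: expr where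
  "log_expr = Mul (Const 2) (Ln (Div (Const 12) (Reg 2)))"

text \<open>Registers 0, 1, 2 hold y, b, \<delta>. Register 3 counts the rounds, 4 and 5 hold the
  current uniform and normal draws, and 6 holds the last accepted proposal.\<close>

definition round_prog :: prog where
  "round_prog =
     Seq (SampleUniform 4) (Seq (SampleNormal 5)
       (Seq (IfLess (Reg 4) (Sub (Const 1) (Div (Mul (Reg 5) (Reg 5)) (Add log_expr (Const 1))))
               (Assign 6 (Reg 5)) Skip)
         (Assign 3 (Add (Reg 3) (Const 1)))))"

text \<open>The counter runs through 0, 1, 2, ..., so comparing it with 1 / \<delta> yields exactly
  \<lceil>1 / \<delta>\<rceil> rounds although the machine has no rounding operation.\<close>

definition loop_prog :: prog where
  "loop_prog = WhileLess (Reg 3) (Div (Const 1) (Reg 2)) round_prog"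

text \<open>Register 6 is initially 0, so y is returned unchanged if no proposal is
  accepted.\<close>

definition kernel_prog :: prog where
  "kernel_prog = Seq loop_prog
     (Assign 0 (Add (Reg 0) (Mul (Mul (Reg 1) (Sqrt log_expr)) (Reg 6))))"

section \<open>Execution and running time of the program\<close>

lemma exec_round:
  assumes "s 2 = \<delta>" "c = 2 * ln (12 / \<delta>) + 1"
  shows "\<exists>t\<le>30. \<exists>s'. exec round_prog (s, u, z) t (s', stl u, stl z) \<and>
    s' 0 = s 0 \<and> s' 1 = s 1 \<and> s' 2 = s 2 \<and> s' 3 = s 3 + 1 \<and>
    s' 6 = (if shd u < 1 - (shd z)\<^sup>2 / c then shd z else s 6)"
proof -
  define s1 where "s1 = s(4 := shd u)"
  define s2 where "s2 = s1(5 := shd z)"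
  define s3 where "s3 = (if shd u < 1 - (shd z)\<^sup>2 / c then s2(6 := shd z) else s2)"
  define e where "e = Sub (Const 1) (Div (Mul (Reg 5) (Reg 5)) (Add log_expr (Const 1)))"
  have vals: "val s2 (Reg 4) = shd u" "val s2 e = 1 - (shd z)\<^sup>2 / c"
    using assms by (simp_all add: s2_def s1_def e_def log_expr_def power2_eq_square)
  have cost_e: "cost e = 14"
    by (simp add: e_def log_expr_def)
  \<comment> \<open>The test costs 1 + 1 + 14 and the longer branch costs 2; the bound 20 leaves
    slack.\<close>
  have if_step: "\<exists>t\<le>20. exec (IfLess (Reg 4) e (Assign 6 (Reg 5)) Skip)
      (s2, stl u, stl z) t (s3, stl u, stl z)"
  proof (cases "shd u < 1 - (shd z)\<^sup>2 / c")
    case True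
    have "exec (Assign 6 (Reg 5)) (s2, stl u, stl z) (1 + cost (Reg 5)) (s2(6 := val s2 (Reg 5)), stl u, stl z)"
      by (rule exec.Assign)
    moreover have "s2(6 := val s2 (Reg 5)) = s3"
      using True by (simp add: s3_def s2_def)
    ultimately show ?thesis
      using True vals cost_e
      by (intro exI[of _ "1 + cost (Reg 4) + cost e + (1 + cost (Reg 5))"] conjI exec.IfTrue)
         simp_all
  next
    case False
    then have "s3 = s2"
      by (simp add: s3_def)
    with False show ?thesis
      using vals cost_e
      by (intro exI[of _ "1 + cost (Reg 4) + cost e + 1"] conjI exec.IfFalse)
         (simp_all add: exec.Skip[unfolded One_nat_def])
  qed
  then obtain t where t: "t \<le> 20"
    "exec (IfLess (Reg 4) e (Assign 6 (Reg 5)) Skip) (s2, stl u, stl z) t (s3, stl u, stl z)"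
    by blast
  have "exec round_prog (s, u, z) (1 + (1 + (t + (1 + cost (Add (Reg 3) (Const 1))))))
      (s3(3 := val s3 (Add (Reg 3) (Const 1))), stl u, stl z)"
    unfolding round_prog_def e_def[symmetric]
    using exec.Seq[OF t(2) exec.Assign]
    by (intro exec.Seq[OF exec.SampleUniform] exec.Seq[OF exec.SampleNormal])
       (simp only: s1_def s2_def)
  moreover have "1 + (1 + (t + (1 + cost (Add (Reg 3) (Const 1))))) \<le> 30"
    using t by simp
  ultimately show ?thesis
    by (intro exI conjI) (assumption, assumption, auto simp: s3_def s2_def s1_def)
qed

text \<open>Here \<open>n\<close> is the number of rounds still to run, and the assumption on
  register 3 is the loop invariant. A test costs 5 and a round at most 30, hence 40 per iteration
  and 6 for the final failing test.\<close>

lemma exec_loop: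
  assumes "s 2 = \<delta>" "c = 2 * ln (12 / \<delta>) + 1" "s 3 + real n = real (nat \<lceil>1 / \<delta>\<rceil>)" "\<delta> > 0"
  shows "\<exists>t\<le>6 + 40 * n. \<exists>s' u' z'. exec loop_prog (s, u, z) t (s', u', z') \<and>
    s' 0 = s 0 \<and> s' 1 = s 1 \<and> s' 2 = s 2 \<and> s' 6 = rejection n c (s 6) u z"
  using assms
proof (induction n arbitrary: s u z)
  case 0
  then have "\<not> val s (Reg 3) < val s (Div (Const 1) (Reg 2))"
    by (simp add: not_less)
  then have "exec loop_prog (s, u, z) (1 + cost (Reg 3) + cost (Div (Const 1) (Reg 2))) (s, u, z)"
    unfolding loop_prog_def by (intro exec.WhileFalse) simp
  then show ?case
    by (intro exI[of _ "1 + cost (Reg 3) + cost (Div (Const 1) (Reg 2))"] conjI exI[of _ s] exI) auto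
next
  case (Suc n)
  \<comment> \<open>The counter equals \<lceil>1 / \<delta>\<rceil> - (n + 1), and a ceiling minus
    one lies strictly below its argument.\<close>
  have "s 3 < 1 / \<delta>"
  proof -
    have "0 \<le> \<lceil>1 / \<delta>\<rceil>"
      using Suc.prems(4) by (smt (verit) zero_le_ceiling divide_nonneg_nonneg)
    then show ?thesis
      using Suc.prems(3) by simp linarith
  qed
  then have less: "val (fst (s, u, z)) (Reg 3) < val (fst (s, u, z)) (Div (Const 1) (Reg 2))"
    using Suc.prems(1) by simp
  obtain t s' where t: "t \<le> 30" and s': "exec round_prog (s, u, z) t (s', stl u, stl z)"
    "s' 0 = s 0" "s' 1 = s 1" "s' 2 = s 2" "s' 3 = s 3 + 1"
    "s' 6 = (if shd u < 1 - (shd z)\<^sup>2 / c then shd z else s 6)"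
    using exec_round[of s \<delta> c u z] Suc.prems by blast
  have "s' 3 + real n = real (nat \<lceil>1 / \<delta>\<rceil>)"
    using s'(5) Suc.prems(3) by simp
  then obtain t' s'' u' z' where t': "t' \<le> 6 + 40 * n"
    and s'': "exec loop_prog (s', stl u, stl z) t' (s'', u', z')"
    "s'' 0 = s' 0" "s'' 1 = s' 1" "s'' 2 = s' 2" "s'' 6 = rejection n c (s' 6) (stl u) (stl z)"
    using Suc.IH[of s' "stl u" "stl z"] Suc.prems s'(4) by auto
  have "exec loop_prog (s, u, z) (1 + cost (Reg 3) + cost (Div (Const 1) (Reg 2)) + t + t') (s'', u', z')"
    using exec.WhileTrue[OF less s'(1) s''(1)[unfolded loop_prog_def]]
    unfolding loop_prog_def .
  moreover have "1 + cost (Reg 3) + cost (Div (Const 1) (Reg 2)) + t + t' \<le> 6 + 40 * Suc n"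
    using t t' by simp
  ultimately show ?case
    using s' s'' by (intro exI conjI) (assumption, assumption, auto)
qed

lemma exec_kernel_prog:
  fixes \<delta> :: real
  assumes "0 < \<delta>" and "c = 2 * ln (12 / \<delta>) + 1"
  shows "\<exists>t\<le>30 + 40 * nat \<lceil>1 / \<delta>\<rceil>. \<exists>s' \<omega>'. exec kernel_prog (init [y, b, \<delta>], u, z) t (s', \<omega>') \<and>
    s' 0 = y + b * sqrt (2 * ln (12 / \<delta>)) * rejection (nat \<lceil>1 / \<delta>\<rceil>) c 0 u z"
proof -
  define s where "s = init [y, b, \<delta>]"
  have s: "s 0 = y" "s 1 = b" "s 2 = \<delta>" "s 3 = 0" "s 6 = 0"
    by (simp_all add: s_def init_def)
  obtain t s' u' z' where t: "t \<le> 6 + 40 * nat \<lceil>1 / \<delta>\<rceil>"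
    and s': "exec loop_prog (s, u, z) t (s', u', z')"
    "s' 0 = y" "s' 1 = b" "s' 2 = \<delta>" "s' 6 = rejection (nat \<lceil>1 / \<delta>\<rceil>) c 0 u z"
    using exec_loop[of s \<delta> c "nat \<lceil>1 / \<delta>\<rceil>" u z] assms s by auto
  define e where "e = Add (Reg 0) (Mul (Mul (Reg 1) (Sqrt log_expr)) (Reg 6))"
  have "exec kernel_prog (s, u, z) (t + (1 + cost e)) (s'(0 := val s' e), u', z')"
    unfolding kernel_prog_def e_def[symmetric] by (intro exec.Seq[OF s'(1)] exec.Assign)
  moreover have "t + (1 + cost e) \<le> 30 + 40 * nat \<lceil>1 / \<delta>\<rceil>"
    using t by (simp add: e_def log_expr_def)
  moreover have "val s' e = y + b * sqrt (2 * ln (12 / \<delta>)) * rejection (nat \<lceil>1 / \<delta>\<rceil>) c 0 u z"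
    by (simp add: e_def log_expr_def s' del: One_nat_def)
  ultimately show ?thesis
    unfolding s_def[symmetric] by (intro exI conjI) (assumption, assumption, simp)
qed

lemma result_kernel_prog:
  fixes \<delta> :: real
  assumes "0 < \<delta>"
  shows "result kernel_prog [y, b, \<delta>] \<omega> =
    y + b * sqrt (2 * ln (12 / \<delta>)) *
      rejection (nat \<lceil>1 / \<delta>\<rceil>) (2 * ln (12 / \<delta>) + 1) 0 (fst \<omega>) (snd \<omega>)"
proof -
  obtain t s' \<omega>' where "exec kernel_prog (init [y, b, \<delta>], fst \<omega>, snd \<omega>) t (s', \<omega>')"
    and s': "s' 0 = y + b * sqrt (2 * ln (12 / \<delta>)) *
      rejection (nat \<lceil>1 / \<delta>\<rceil>) (2 * ln (12 / \<delta>) + 1) 0 (fst \<omega>) (snd \<omega>)"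
    using exec_kernel_prog[OF assms refl] by blast
  then have "result kernel_prog [y, b, \<delta>] \<omega> = s' 0"
    by (intro result_eq) simp
  with s' show ?thesis by simp
qed

text \<open>The number of rounds does not depend on the draws, so the bound 30 + 40 \<lceil>1 /
  \<delta>\<rceil> holds on every tape. Rounding up adds at most 1, which gives 70 + 40 /
  \<delta>.\<close>

lemma halts_within_kernel_prog:
  fixes \<delta> :: real
  assumes "0 < \<delta>"
  shows "halts_within kernel_prog [y, b, \<delta>] (poly [:70, 40:] (1 / \<delta>))"
  unfolding halts_within_def
proof
  fix \<omega> :: "real stream \<times> real stream"
  obtain t c' where t: "t \<le> 30 + 40 * nat \<lceil>1 / \<delta>\<rceil>"
    and ex: "exec kernel_prog (init [y, b, \<delta>], \<omega>) t c'"
    using exec_kernel_prog[OF assms refl, of y b "fst \<omega>" "snd \<omega>"] by auto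
  have "0 \<le> 1 / \<delta>"
    using assms by simp
  then have "real (nat \<lceil>1 / \<delta>\<rceil>) \<le> 1 / \<delta> + 1"
    by linarith
  moreover have "real t \<le> 30 + 40 * real (nat \<lceil>1 / \<delta>\<rceil>)"
    using t by linarith
  ultimately have "real t \<le> poly [:70, 40:] (1 / \<delta>)"
    by simp
  with ex show "\<exists>t c'. exec kernel_prog (init [y, b, \<delta>], \<omega>) t c' \<and> real t \<le> poly [:70, 40:] (1 / \<delta>)"
    by blast
qed

subsection \<open>The law of rejection sampling\<close>

lemma prob_space_std_normal: "prob_space std_normal_distribution"
  by (rule prob_space_normal_density) simp

lemma measurable_rejection [measurable]:
  "(\<lambda>(w, u, z). rejection n c w u z)
     \<in> borel \<Otimes>\<^sub>M stream_space borel \<Otimes>\<^sub>M stream_space borel \<rightarrow>\<^sub>M borel"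
proof (induction n)
  case 0
  then show ?case by simp
next
  case (Suc n)
  note [measurable] = Suc
  have "(\<lambda>x. case (case x of (w, u, z) \<Rightarrow> (if shd u < 1 - (shd z)\<^sup>2 / c then shd z else w, stl u, stl z))
      of (w, u, z) \<Rightarrow> rejection n c w u z)
      \<in> borel \<Otimes>\<^sub>M stream_space borel \<Otimes>\<^sub>M stream_space borel \<rightarrow>\<^sub>M borel"
    by (rule measurable_compose[OF _ Suc]) measurable
  also have "(\<lambda>x. case (case x of (w, u, z) \<Rightarrow> (if shd u < 1 - (shd z)\<^sup>2 / c then shd z else w, stl u, stl z))
      of (w, u, z) \<Rightarrow> rejection n c w u z) = (\<lambda>(w, u, z). rejection (Suc n) c w u z)"
    by (auto simp: fun_eq_iff)
  finally show ?case .
qed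

lemma sets_coins [measurable_cong]:
  "sets coins = sets (stream_space borel \<Otimes>\<^sub>M stream_space borel)"
  unfolding coins_def by (intro sets_pair_measure_cong sets_stream_space_cong) simp_all

text \<open>Splits off the heads of both tapes, which are independent of the tails. The normal head
  is integrated outermost so that the uniform head can be integrated out for a fixed proposal
  \<open>v\<close>.\<close>

lemma nn_integral_coins:
  assumes [measurable]: "F \<in> borel_measurable (stream_space borel \<Otimes>\<^sub>M stream_space borel)"
  shows "(\<integral>\<^sup>+\<omega>. F \<omega> \<partial>coins) =
    (\<integral>\<^sup>+v. \<integral>\<^sup>+x. \<integral>\<^sup>+\<omega>. F (x ## fst \<omega>, v ## snd \<omega>) \<partial>coins \<partial>uniform_measure lborel {0..1}
       \<partial>std_normal_distribution)"
proof -
  let ?U = "uniform_measure lborel {0..1::real}" and ?N = "std_normal_distribution"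
  interpret U: prob_space ?U
    by (rule prob_space_uniform_measure) auto
  interpret N: prob_space ?N
    by (rule prob_space_std_normal)
  interpret SU: prob_space "stream_space ?U" by (rule U.prob_space_stream_space)
  interpret SN: prob_space "stream_space ?N" by (rule N.prob_space_stream_space)
  interpret UN: pair_prob_space ?U "stream_space ?U" ..
  interpret P: pair_sigma_finite "stream_space ?U" ?N ..
  interpret Q: pair_sigma_finite ?U ?N ..
  have [measurable_cong]: "sets (stream_space ?U) = sets (stream_space borel)"
    "sets (stream_space ?N) = sets (stream_space borel)"
    by (intro sets_stream_space_cong; simp)+
  have "(\<integral>\<^sup>+\<omega>. F \<omega> \<partial>coins) = (\<integral>\<^sup>+u. \<integral>\<^sup>+z. F (u, z) \<partial>stream_space ?N \<partial>stream_space ?U)"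
    unfolding coins_def by (rule SN.nn_integral_fst[symmetric]) measurable
  also have "\<dots> = (\<integral>\<^sup>+x. \<integral>\<^sup>+u. \<integral>\<^sup>+z. F (x ## u, z) \<partial>stream_space ?N \<partial>stream_space ?U \<partial>?U)"
    by (rule U.nn_integral_stream_space) measurable
  also have "\<dots> = (\<integral>\<^sup>+x. \<integral>\<^sup>+u. \<integral>\<^sup>+v. \<integral>\<^sup>+z. F (x ## u, v ## z) \<partial>stream_space ?N \<partial>?N \<partial>stream_space ?U \<partial>?U)"
    by (intro nn_integral_cong N.nn_integral_stream_space) (simp_all add: space_stream_space)
  also have "\<dots> = (\<integral>\<^sup>+x. \<integral>\<^sup>+v. \<integral>\<^sup>+u. \<integral>\<^sup>+z. F (x ## u, v ## z) \<partial>stream_space ?N \<partial>stream_space ?U \<partial>?N \<partial>?U)"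
    by (intro nn_integral_cong P.Fubini'[symmetric]) measurable
  also have "\<dots> = (\<integral>\<^sup>+x. \<integral>\<^sup>+v. \<integral>\<^sup>+\<omega>. F (x ## fst \<omega>, v ## snd \<omega>) \<partial>coins \<partial>?N \<partial>?U)"
    unfolding coins_def
    by (intro nn_integral_cong, subst SN.nn_integral_fst[symmetric]) simp_all
  also have "\<dots> = (\<integral>\<^sup>+v. \<integral>\<^sup>+x. \<integral>\<^sup>+\<omega>. F (x ## fst \<omega>, v ## snd \<omega>) \<partial>coins \<partial>?U \<partial>?N)"
  proof -
    interpret C: prob_space coins by (rule prob_space_coins)
    show ?thesis
      by (rule Q.Fubini'[symmetric]) measurable
  qed
  finally show ?thesis .
qed

definition accept :: "real \<Rightarrow> real \<Rightarrow> real" where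
  "accept c z = max 0 (1 - z\<^sup>2 / c)"

lemma borel_measurable_accept [measurable]: "accept c \<in> borel_measurable borel"
  unfolding accept_def[abs_def] by measurable

lemma accept_bounds: "0 \<le> accept c z" "0 < c \<Longrightarrow> accept c z \<le> 1"
  by (auto simp: accept_def)

text \<open>The threshold is at most 1, and a uniform draw from [0, 1] cannot distinguish a negative
  threshold from 0. This is the truncation in \<open>accept\<close>.\<close>

lemma nn_integral_uniform_less:
  fixes a :: real and A B :: ennreal
  assumes "0 < c"
  shows "(\<integral>\<^sup>+x. (if x < 1 - z\<^sup>2 / c then A else B) \<partial>uniform_measure lborel {0..1}) =
    ennreal (accept c z) * A + ennreal (1 - accept c z) * B"
proof -
  let ?U = "uniform_measure lborel {0..1::real}" and ?r = "1 - z\<^sup>2 / c"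
  have r: "?r \<le> 1" "accept c z = max 0 ?r"
    using assms by (auto simp: accept_def)
  have "(\<integral>\<^sup>+x. (if x < ?r then A else B) \<partial>?U) =
      (\<integral>\<^sup>+x. A * indicator {..<?r} x + B * indicator {?r..} x \<partial>?U)"
    by (intro nn_integral_cong) (auto split: split_indicator)
  also have "\<dots> = A * emeasure ?U {..<?r} + B * emeasure ?U {?r..}"
    by (subst nn_integral_add) (simp_all add: nn_integral_cmult_indicator)
  also have "emeasure ?U {..<?r} = emeasure lborel ({0..1} \<inter> {..<?r})"
    by (simp add: divide_ennreal_def)
  also have "{0..1} \<inter> {..<?r} = {0..<?r}"
    using r by auto
  also have "emeasure lborel {0..<?r} = ennreal (accept c z)"
    using r by (cases "0 \<le> ?r") (auto simp: max_def)
  also have "emeasure ?U {?r..} = emeasure lborel ({0..1} \<inter> {?r..})"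
    by (simp add: divide_ennreal_def)
  also have "{0..1} \<inter> {?r..} = {accept c z..1}"
    using r by auto
  also have "emeasure lborel {accept c z..1} = ennreal (1 - accept c z)"
    using accept_bounds[of c z] assms by auto
  finally show ?thesis
    by (simp add: mult.commute)
qed

lemma nn_integral_accept_complement:
  assumes "0 < c"
  shows "(\<integral>\<^sup>+z. accept c z \<partial>std_normal_distribution) +
    (\<integral>\<^sup>+z. 1 - accept c z \<partial>std_normal_distribution) = 1"
proof -
  interpret N: prob_space std_normal_distribution
    by (rule prob_space_std_normal)
  have "(\<integral>\<^sup>+z. accept c z \<partial>std_normal_distribution) +
      (\<integral>\<^sup>+z. 1 - accept c z \<partial>std_normal_distribution) =
      (\<integral>\<^sup>+z. ennreal (accept c z) + ennreal (1 - accept c z) \<partial>std_normal_distribution)"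
    by (rule nn_integral_add[symmetric]) measurable
  also have "\<dots> = (\<integral>\<^sup>+z. 1 \<partial>std_normal_distribution)"
    using accept_bounds assms
    by (intro nn_integral_cong) (simp add: ennreal_plus[symmetric] del: ennreal_plus)
  finally show ?thesis
    using N.emeasure_space_1 by simp
qed

text \<open>With probability \<open>q ^ n\<close> all rounds reject and the initial \<open>w\<close>
  survives. Otherwise the last acceptance is followed by some number \<open>i < n\<close> of
  rejections, which contributes the weight \<open>q ^ i\<close>; the unnormalised law of the
  accepted proposal is the same each time.\<close>

lemma nn_integral_rejection:
  fixes F :: "real \<Rightarrow> ennreal"
  assumes [measurable]: "F \<in> borel_measurable borel" and c: "0 < c"
  defines "q \<equiv> \<integral>\<^sup>+z. 1 - accept c z \<partial>std_normal_distribution"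
  shows "(\<integral>\<^sup>+\<omega>. F (rejection n c w (fst \<omega>) (snd \<omega>)) \<partial>coins) =
    q ^ n * F w + (\<Sum>i<n. q ^ i) * (\<integral>\<^sup>+z. accept c z * F z \<partial>std_normal_distribution)"
proof (induction n arbitrary: w)
  case 0
  interpret C: prob_space coins by (rule prob_space_coins)
  show ?case using C.emeasure_space_1 by simp
next
  case (Suc n)
  let ?N = std_normal_distribution and ?U = "uniform_measure lborel {0..1::real}"
  interpret N: prob_space ?N
    by (rule prob_space_std_normal)
  define p where "p = (\<integral>\<^sup>+z. accept c z \<partial>?N)"
  define \<kappa> where "\<kappa> = (\<integral>\<^sup>+z. accept c z * F z \<partial>?N)"
  define S where "S = (\<Sum>i<n. q ^ i)"
  have pq: "p + q = 1"
    using nn_integral_accept_complement[OF c] by (simp add: p_def q_def)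
  have "(\<integral>\<^sup>+\<omega>. F (rejection (Suc n) c w (fst \<omega>) (snd \<omega>)) \<partial>coins) =
     (\<integral>\<^sup>+v. \<integral>\<^sup>+x. \<integral>\<^sup>+\<omega>. F (rejection n c (if x < 1 - v\<^sup>2 / c then v else w) (fst \<omega>) (snd \<omega>)) \<partial>coins \<partial>?U \<partial>?N)"
    by (subst nn_integral_coins) (measurable, simp cong: if_cong)
  also have "\<dots> = (\<integral>\<^sup>+v. \<integral>\<^sup>+x. (if x < 1 - v\<^sup>2 / c then q ^ n * F v + S * \<kappa> else q ^ n * F w + S * \<kappa>) \<partial>?U \<partial>?N)"
    by (intro nn_integral_cong) (simp add: Suc.IH \<kappa>_def S_def)
  also have "\<dots> = (\<integral>\<^sup>+v. accept c v * (q ^ n * F v + S * \<kappa>) + ennreal (1 - accept c v) * (q ^ n * F w + S * \<kappa>) \<partial>?N)"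
    by (simp only: nn_integral_uniform_less[OF c])
  also have "\<dots> = (\<integral>\<^sup>+v. q ^ n * (accept c v * F v) + (accept c v * (S * \<kappa>)
      + ennreal (1 - accept c v) * (q ^ n * F w + S * \<kappa>)) \<partial>?N)"
    by (intro nn_integral_cong) (simp add: algebra_simps)
  also have "\<dots> = q ^ n * \<kappa> + (p * (S * \<kappa>) + q * (q ^ n * F w + S * \<kappa>))"
    by (simp add: nn_integral_add nn_integral_cmult nn_integral_multc \<kappa>_def p_def q_def)
  \<comment> \<open>The later rounds contribute \<open>S * \<kappa>\<close> whatever the first round
    does, hence the factor \<open>p + q\<close>. The first proposal survives with weight
    \<open>q ^ n\<close>, the new term of the geometric sum.\<close>
  also have "\<dots> = q ^ Suc n * F w + (q ^ n * \<kappa> + (p + q) * (S * \<kappa>))"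
    by (simp add: algebra_simps)
  also have "\<dots> = q ^ Suc n * F w + (\<Sum>i<Suc n. q ^ i) * \<kappa>"
    by (simp add: pq S_def algebra_simps)
  finally show ?case
    by (simp add: \<kappa>_def)
qed

subsection \<open>The Laplace and normal laws\<close>

definition laplace_density :: "real \<Rightarrow> real \<Rightarrow> real" where
  "laplace_density b x = 1 / (2 * b) * exp (- \<bar>x\<bar> / b)"

lemma borel_measurable_laplace_density [measurable]: "laplace_density b \<in> borel_measurable borel"
  unfolding laplace_density_def[abs_def] by measurable

lemma laplace_density_nonneg: "0 < b \<Longrightarrow> 0 \<le> laplace_density b x"
  by (simp add: laplace_density_def)

lemma laplace_eq: "laplace b = density lborel (laplace_density b)"
  by (simp add: laplace_def laplace_density_def)

lemma sets_laplace [simp, measurable_cong]: "sets (laplace b) = sets borel"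
  by (simp add: laplace_def)

lemma nn_integral_laplace:
  fixes F :: "real \<Rightarrow> ennreal"
  assumes "F \<in> borel_measurable borel"
  shows "(\<integral>\<^sup>+x. F x \<partial>laplace b) = (\<integral>\<^sup>+x. laplace_density b x * F x \<partial>lborel)"
  using assms unfolding laplace_eq by (subst nn_integral_density) auto

text \<open>The Laplace density is the symmetrised exponential density, and an even power weighs
  both halves equally. The case 0 gives the total mass, the case 2 the variance.\<close>

lemma nn_integral_laplace_even_moment:
  assumes "0 < b" "even i"
  shows "(\<integral>\<^sup>+x. ennreal (x ^ i) \<partial>laplace b) = ennreal (fact i * b ^ i)"
proof -
  let ?E = "\<lambda>x. ennreal (exponential_density (1 / b) x * x ^ i)"
  have E: "(\<integral>\<^sup>+x. ?E x \<partial>lborel) = ennreal (fact i * b ^ i)"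
    using nn_integral_erlang_ith_moment[of "1 / b" 0 i] assms
    by (simp add: power_one_over divide_simps)
  have "(\<integral>\<^sup>+x. ennreal (x ^ i) \<partial>laplace b) = (\<integral>\<^sup>+x. laplace_density b x * ennreal (x ^ i) \<partial>lborel)"
    by (rule nn_integral_laplace) measurable
  also have "\<dots> = (\<integral>\<^sup>+x. ennreal (1 / 2) * (?E x + ?E (- x)) \<partial>lborel)"
  proof (rule nn_integral_cong_AE)
    \<comment> \<open>At 0 both exponential halves are positive and their average is twice the
      Laplace density.\<close>
    have "AE x::real in lborel. x \<noteq> 0"
      by (rule AE_lborel_singleton)
    then show "AE x in lborel. laplace_density b x * ennreal (x ^ i) = ennreal (1 / 2) * (?E x + ?E (- x))"
    proof (rule eventually_mono)
      fix x :: real assume x: "x \<noteq> 0"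
      have xi: "0 \<le> x ^ i" "(- x) ^ i = x ^ i"
        using assms(2) by (auto simp: zero_le_even_power)
      have nonneg: "0 \<le> exponential_density (1 / b) y" for y
        using assms by (intro erlang_density_nonneg) simp
      have "ennreal (1 / 2) * (?E x + ?E (- x)) =
          ennreal (1 / 2 * (exponential_density (1 / b) x + exponential_density (1 / b) (- x)) * x ^ i)"
        using xi nonneg by (simp add: ennreal_mult[symmetric] ennreal_plus[symmetric] algebra_simps
          del: ennreal_plus ennreal_half)
      also have "1 / 2 * (exponential_density (1 / b) x + exponential_density (1 / b) (- x)) = laplace_density b x"
        using x by (cases "x < 0") (auto simp: laplace_density_def exponential_density_def)
      finally show "laplace_density b x * ennreal (x ^ i) = ennreal (1 / 2) * (?E x + ?E (- x))"
        using xi assms by (simp add: ennreal_mult laplace_density_nonneg)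
    qed
  qed
  also have "\<dots> = ennreal (1 / 2) * ((\<integral>\<^sup>+x. ?E x \<partial>lborel) + (\<integral>\<^sup>+x. ?E (- x) \<partial>lborel))"
    by (simp add: nn_integral_cmult nn_integral_add)
  also have "(\<integral>\<^sup>+x. ?E (- x) \<partial>lborel) = (\<integral>\<^sup>+x. ?E x \<partial>lborel)"
    using nn_integral_real_affine[of ?E "- 1" 0] by simp
  also have "ennreal (1 / 2) * ((\<integral>\<^sup>+x. ?E x \<partial>lborel) + (\<integral>\<^sup>+x. ?E x \<partial>lborel)) = ennreal (fact i * b ^ i)"
    unfolding E using assms
    by (simp add: ennreal_mult[symmetric] ennreal_plus[symmetric] del: ennreal_plus ennreal_half)
  finally show ?thesis .
qed

lemma prob_space_laplace:
  assumes "0 < b"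
  shows "prob_space (laplace b)"
proof
  show "emeasure (laplace b) (space (laplace b)) = 1"
    using nn_integral_laplace_even_moment[OF assms, of 0] by simp
qed

lemma nn_integral_std_normal:
  fixes F :: "real \<Rightarrow> ennreal"
  assumes "F \<in> borel_measurable borel"
  shows "(\<integral>\<^sup>+x. F x \<partial>std_normal_distribution) = (\<integral>\<^sup>+x. std_normal_density x * F x \<partial>lborel)"
  using assms by (subst nn_integral_density) auto

lemma nn_integral_std_normal_square: "(\<integral>\<^sup>+z. ennreal (z\<^sup>2) \<partial>std_normal_distribution) = 1"
proof -
  have *: "has_bochner_integral lborel (\<lambda>z. std_normal_density z * z\<^sup>2) 1"
    using std_normal_moment_even[of 1] by (simp add: numeral_2_eq_2)
  have "(\<integral>\<^sup>+z. ennreal (z\<^sup>2) \<partial>std_normal_distribution) = (\<integral>\<^sup>+z. ennreal (std_normal_density z * z\<^sup>2) \<partial>lborel)"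
    by (subst nn_integral_std_normal) (simp_all add: ennreal_mult)
  also have "\<dots> = ennreal 1"
    using * by (subst nn_integral_eq_integral) (auto simp: has_bochner_integral_iff)
  finally show ?thesis by simp
qed

lemma normal_density_scale:
  assumes "0 < \<sigma>"
  shows "\<sigma> * normal_density 0 \<sigma> (\<sigma> * z) = std_normal_density z"
  using assms by (simp add: normal_density_def real_sqrt_mult power_mult_distrib)

subsection \<open>Inverting the convolution with the Laplace law\<close>

text \<open>This is \<phi> - b^2 \<phi>'' written out with \<phi>'' = \<phi> (w^2 / \<sigma>^4 - 1 /
  \<sigma>^2).\<close>

definition deconv :: "real \<Rightarrow> real \<Rightarrow> real \<Rightarrow> real" where
  "deconv b \<sigma> w = normal_density 0 \<sigma> w * (1 + b\<^sup>2 / \<sigma>\<^sup>2 - b\<^sup>2 * w\<^sup>2 / \<sigma> ^ 4)"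

lemma borel_measurable_deconv [measurable]: "deconv b \<sigma> \<in> borel_measurable borel"
  unfolding deconv_def[abs_def] by measurable

lemma integrable_normal_quadratic:
  assumes "0 < \<sigma>"
  shows "integrable lborel (\<lambda>w. normal_density 0 \<sigma> w * (A + B * w\<^sup>2))"
proof -
  have "integrable lborel (\<lambda>w. A * normal_density 0 \<sigma> w + B * (normal_density 0 \<sigma> w * w\<^sup>2))"
    using integrable_normal_moment[OF assms, of 0 2] assms by simp
  then show ?thesis
    by (simp add: algebra_simps)
qed

lemma integrable_deconv:
  assumes "0 < \<sigma>"
  shows "integrable lborel (deconv b \<sigma>)"
  using integrable_normal_quadratic[OF assms, of "1 + b\<^sup>2 / \<sigma>\<^sup>2" "- (b\<^sup>2 / \<sigma> ^ 4)"]
  by (simp add: deconv_def[abs_def] algebra_simps)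

lemma integrable_laplace_density_mult:
  fixes g :: "real \<Rightarrow> real"
  assumes "0 < b" "integrable lborel g"
  shows "integrable lborel (\<lambda>w. laplace_density b (x - w) * g w)"
proof (rule Bochner_Integration.integrable_bound)
  show "integrable lborel (\<lambda>w. 1 / (2 * b) * g w)"
    using assms by simp
  have [measurable]: "g \<in> borel_measurable borel"
    using assms(2) by simp
  show "(\<lambda>w. laplace_density b (x - w) * g w) \<in> borel_measurable lborel"
    by measurable
  have "laplace_density b y \<le> 1 / (2 * b)" for y
    using assms(1) by (simp add: laplace_density_def divide_simps)
  then have "norm (laplace_density b (x - w) * g w) \<le> norm (1 / (2 * b) * g w)" for w
    using assms(1) laplace_density_nonneg[OF assms(1), of "x - w"]
    unfolding norm_mult by (intro mult_right_mono) simp_all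
  then show "AE w in lborel. norm (laplace_density b (x - w) * g w) \<le> norm (1 / (2 * b) * g w)"
    by simp
qed

lemma DERIV_normal_density:
  assumes "0 < \<sigma>"
  shows "(normal_density 0 \<sigma> has_real_derivative - (w / \<sigma>\<^sup>2) * normal_density 0 \<sigma> w) (at w)"
  unfolding normal_density_def[abs_def] using assms
  by (auto intro!: derivative_eq_intros simp: field_simps power2_eq_square)

text \<open>With \<open>\<phi>\<close> the normal density, the antiderivative of \<open>(\<phi> - b\<^sup>2 \<phi>'') exp (w / b)\<close> is
  \<open>b (\<phi> - b \<phi>') exp (w / b)\<close>.\<close>

lemma half_laplace_deconv:
  assumes b: "0 < b" and \<sigma>: "0 < \<sigma>"
  shows "(LINT w|lborel. indicator {..<x} w * (laplace_density b (x - w) * deconv b \<sigma> w)) =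
    normal_density 0 \<sigma> x * (1 + b * x / \<sigma>\<^sup>2) / 2"
proof -
  define f where "f = (\<lambda>w. 1 / (2 * b) * exp ((w - x) / b) * deconv b \<sigma> w)"
  define F where "F = (\<lambda>w. normal_density 0 \<sigma> w * (1 + b * w / \<sigma>\<^sup>2) * exp ((w - x) / b) / 2)"
  have eq: "indicator {..<x} w * (laplace_density b (x - w) * deconv b \<sigma> w) = indicator {..<x} w * f w" for w
  proof (cases "w < x")
    case True
    then have "- \<bar>x - w\<bar> / b = (w - x) / b"
      by simp
    then show ?thesis
      by (simp only: f_def laplace_density_def)
  qed simp
  have "(LBINT w=-\<infinity>..x. f w) = F x - 0"
  proof (rule interval_integral_FTC_integrable)
    show "(F has_vector_derivative f w) (at w)" for w
    proof -
      have "((\<lambda>w. 1 + b * w / \<sigma>\<^sup>2) has_real_derivative b / \<sigma>\<^sup>2) (at w)"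
        using b \<sigma> by (auto intro!: derivative_eq_intros simp: power2_eq_square power4_eq_xxxx)
      moreover have "((\<lambda>w. exp ((w - x) / b)) has_real_derivative exp ((w - x) / b) / b) (at w)"
        using b by (auto intro!: derivative_eq_intros)
      ultimately have "(F has_real_derivative
          ((- (w / \<sigma>\<^sup>2) * normal_density 0 \<sigma> w * (1 + b * w / \<sigma>\<^sup>2)
            + b / \<sigma>\<^sup>2 * normal_density 0 \<sigma> w) * exp ((w - x) / b)
          + exp ((w - x) / b) / b * (normal_density 0 \<sigma> w * (1 + b * w / \<sigma>\<^sup>2))) / 2) (at w)"
        unfolding F_def by (intro DERIV_cdivide DERIV_mult DERIV_normal_density[OF \<sigma>])
      also have "((- (w / \<sigma>\<^sup>2) * normal_density 0 \<sigma> w * (1 + b * w / \<sigma>\<^sup>2)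
            + b / \<sigma>\<^sup>2 * normal_density 0 \<sigma> w) * exp ((w - x) / b)
          + exp ((w - x) / b) / b * (normal_density 0 \<sigma> w * (1 + b * w / \<sigma>\<^sup>2))) / 2 = f w"
      proof -
        \<comment> \<open>Abstracting \<sigma>^2, the density and the exponential to
          \<open>s\<close>, \<open>g\<close> and \<open>e\<close> leaves an identity of rational
          functions.\<close>
        have "((- (w / s) * g * (1 + b * w / s) + b / s * g) * e + e / b * (g * (1 + b * w / s))) / 2 =
            1 / (2 * b) * e * (g * (1 + b\<^sup>2 / s - b\<^sup>2 * w\<^sup>2 / (s * s)))" if "s \<noteq> 0" for s g e
          using b that by (simp add: divide_simps) (simp add: algebra_simps power2_eq_square)
        moreover have "\<sigma> ^ 4 = \<sigma>\<^sup>2 * \<sigma>\<^sup>2"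
          by (simp flip: power_add)
        ultimately show ?thesis
          unfolding f_def deconv_def using \<sigma> by simp
      qed
      finally show ?thesis
        by (simp add: has_real_derivative_iff_has_vector_derivative)
    qed
    show "isCont f w" for w
      unfolding f_def deconv_def normal_density_def using b \<sigma> by (auto intro!: continuous_intros)
    have "integrable lborel (\<lambda>w. indicator {..<x} w *\<^sub>R (laplace_density b (x - w) * deconv b \<sigma> w))"
      using b \<sigma> by (intro integrable_mult_indicator integrable_laplace_density_mult integrable_deconv) auto
    moreover have "einterval (- \<infinity>) (ereal x) = {..<x}"
      by (auto simp: einterval_def)
    ultimately show "set_integrable lborel (einterval (- \<infinity>) (ereal x)) f"
      by (simp add: set_integrable_def eq)
    have "(F \<longlongrightarrow> 0) at_bot"
      unfolding F_def normal_density_def using b \<sigma> by real_asymp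
    then show "((F \<circ> real_of_ereal) \<longlongrightarrow> 0) (at_right (- \<infinity>))"
      by (simp add: ereal_tendsto_simps)
    have "isCont F x"
      unfolding F_def normal_density_def using b \<sigma> by (auto intro!: continuous_intros)
    then have "(F \<longlongrightarrow> F x) (at_left x)"
      by (simp add: isCont_def filterlim_at_split)
    then show "((F \<circ> real_of_ereal) \<longlongrightarrow> F x) (at_left (ereal x))"
      by (simp add: ereal_tendsto_simps)
  qed simp
  also have "(LBINT w=-\<infinity>..x. f w) = (LINT w|lborel. indicator {..<x} w * f w)"
  proof -
    have "einterval (- \<infinity>) (ereal x) = {..<x}"
      by (auto simp: einterval_def)
    then show ?thesis
      by (simp add: interval_lebesgue_integral_def set_lebesgue_integral_def)
  qed
  finally show ?thesis
    by (simp add: eq F_def)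
qed

text \<open>\<open>deconv\<close> is even, so reflection turns the half beyond \<open>x\<close> into
  the half below \<open>- x\<close>. In the sum of the two halves the terms linear in
  \<open>x\<close> cancel.\<close>

lemma integral_laplace_deconv:
  assumes b: "0 < b" and \<sigma>: "0 < \<sigma>"
  shows "(LINT w|lborel. laplace_density b (x - w) * deconv b \<sigma> w) = normal_density 0 \<sigma> x"
proof -
  define g where "g = (\<lambda>x w. laplace_density b (x - w) * deconv b \<sigma> w)"
  have [simp]: "integrable lborel (g x)" for x
    unfolding g_def using b \<sigma> by (intro integrable_laplace_density_mult integrable_deconv)
  have g_uminus: "g x (- w) = g (- x) w" for x w
    by (simp add: g_def deconv_def normal_density_def laplace_density_def abs_minus_commute)
       (simp add: abs_if)
  have int: "integrable lborel (\<lambda>w. indicator A w * g x w)" if "A \<in> sets borel" for A x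
    using integrable_mult_indicator[of A lborel "g x"] that by simp
  have "(LINT w|lborel. g x w) = (LINT w|lborel. indicator {..<x} w * g x w + indicator {x<..} w * g x w)"
    using AE_lborel_singleton[of x]
    by (intro integral_cong_AE) (auto simp: g_def elim!: eventually_mono split: split_indicator)
  also have "\<dots> = (LINT w|lborel. indicator {..<x} w * g x w) + (LINT w|lborel. indicator {x<..} w * g x w)"
    by (intro Bochner_Integration.integral_add int) auto
  also have "(LINT w|lborel. indicator {x<..} w * g x w) = (LINT w|lborel. indicator {..<- x} w * g (- x) w)"
    by (subst lborel_integral_real_affine[of "- 1" _ 0])
       (auto simp: g_uminus intro!: Bochner_Integration.integral_cong split: split_indicator)
  finally show ?thesis
    using half_laplace_deconv[OF b \<sigma>, of x] half_laplace_deconv[OF b \<sigma>, of "- x"]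
    by (simp add: g_def normal_density_def mult.commute add_divide_distrib[symmetric] ring_distribs)
qed

section \<open>The positive and negative parts of the signed density\<close>

definition excess :: "real \<Rightarrow> real \<Rightarrow> real" where
  "excess c z = max 0 (z\<^sup>2 / c - 1)"

lemma borel_measurable_excess [measurable]: "excess c \<in> borel_measurable borel"
  unfolding excess_def[abs_def] by measurable

lemma excess_nonneg: "0 \<le> excess c z"
  by (simp add: excess_def)

lemma accept_eq: "accept c z = (1 - z\<^sup>2 / c) + excess c z"
  by (simp add: accept_def excess_def max_def)

text \<open>For this \<sigma> one has 1 + b^2 / \<sigma>^2 = \<alpha>, so
  \<open>deconv b \<sigma> w\<close> is \<alpha> \<phi>(w) (1 - (w / \<sigma>)^2 / c). Its positive
  part carries \<open>accept\<close> and its negative part \<open>excess\<close>. Moving the latter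
  to the right makes all terms nonnegative; in between, Bochner integrals handle the signed
  function.\<close>

lemma nn_integral_laplace_accept:
  assumes b: "0 < b" and c: "1 < c" and \<sigma>: "\<sigma> = b * sqrt (c - 1)" and \<alpha>: "\<alpha> = c / (c - 1)"
  shows "(\<integral>\<^sup>+w. laplace_density b (x - w) * (normal_density 0 \<sigma> w * (\<alpha> * accept c (w / \<sigma>))) \<partial>lborel) =
    normal_density 0 \<sigma> x +
    (\<integral>\<^sup>+w. laplace_density b (x - w) * (normal_density 0 \<sigma> w * (\<alpha> * excess c (w / \<sigma>))) \<partial>lborel)"
proof -
  have \<sigma>_pos: "0 < \<sigma>" and \<alpha>_pos: "0 < \<alpha>"
    using b c by (auto simp: \<sigma> \<alpha>)
  have \<sigma>2: "\<sigma>\<^sup>2 = b\<^sup>2 * (c - 1)"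
    using c by (simp add: \<sigma> power_mult_distrib)
  have \<sigma>4: "\<sigma> ^ 4 = b\<^sup>2 * b\<^sup>2 * ((c - 1) * (c - 1))"
    using \<sigma>2 by (simp add: power4_eq_xxxx power2_eq_square)
  define a where "a = (\<lambda>w. normal_density 0 \<sigma> w * (\<alpha> * accept c (w / \<sigma>)))"
  define r where "r = (\<lambda>w. normal_density 0 \<sigma> w * (\<alpha> * excess c (w / \<sigma>)))"
  have [measurable]: "a \<in> borel_measurable borel" "r \<in> borel_measurable borel"
    unfolding a_def r_def by measurable
  have "deconv b \<sigma> w = normal_density 0 \<sigma> w * (\<alpha> * (1 - (w / \<sigma>)\<^sup>2 / c))" for w
    unfolding deconv_def power_divide \<sigma>2 \<sigma>4 \<alpha> using b c
    by (simp add: divide_simps) (simp add: algebra_simps power2_eq_square power4_eq_xxxx)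
  then have a_eq: "a w = deconv b \<sigma> w + r w" for w
    by (simp add: a_def r_def accept_eq algebra_simps)
  have nonneg: "0 \<le> a w" "0 \<le> r w" for w
    using \<alpha>_pos accept_bounds(1) excess_nonneg by (auto simp: a_def r_def)
  have int_r: "integrable lborel r"
  proof (rule Bochner_Integration.integrable_bound)
    show "integrable lborel (\<lambda>w. normal_density 0 \<sigma> w * (0 + \<alpha> / (\<sigma>\<^sup>2 * c) * w\<^sup>2))"
      by (rule integrable_normal_quadratic[OF \<sigma>_pos])
    have "excess c (w / \<sigma>) \<le> w\<^sup>2 / (\<sigma>\<^sup>2 * c)" for w
      using c by (simp add: excess_def power_divide)
    then have "r w \<le> normal_density 0 \<sigma> w * (\<alpha> * (w\<^sup>2 / (\<sigma>\<^sup>2 * c)))" for w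
      unfolding r_def using \<alpha>_pos by (intro mult_left_mono) auto
    then show "AE w in lborel. norm (r w) \<le> norm (normal_density 0 \<sigma> w * (0 + \<alpha> / (\<sigma>\<^sup>2 * c) * w\<^sup>2))"
      using nonneg(2) \<alpha>_pos c by (intro always_eventually allI) (simp add: abs_mult)
  qed measurable
  let ?l = "\<lambda>w. laplace_density b (x - w)"
  have int: "integrable lborel (\<lambda>w. ?l w * deconv b \<sigma> w)" "integrable lborel (\<lambda>w. ?l w * r w)"
    using b int_r \<sigma>_pos by (intro integrable_laplace_density_mult integrable_deconv; simp)+
  have eq: "?l w * a w = ?l w * deconv b \<sigma> w + ?l w * r w" for w
    by (simp add: a_eq algebra_simps)
  have "(\<integral>\<^sup>+w. ?l w * a w \<partial>lborel) = ennreal (LINT w|lborel. ?l w * a w)"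
  proof (rule nn_integral_eq_integral)
    show "integrable lborel (\<lambda>w. ?l w * a w)"
      unfolding eq using int by simp
  qed (use nonneg laplace_density_nonneg[OF b] in simp)
  also have "(LINT w|lborel. ?l w * a w) = normal_density 0 \<sigma> x + (LINT w|lborel. ?l w * r w)"
    unfolding eq using int integral_laplace_deconv[OF b \<sigma>_pos, of x] by simp
  also have "ennreal \<dots> = normal_density 0 \<sigma> x + ennreal (LINT w|lborel. ?l w * r w)"
    using nonneg laplace_density_nonneg[OF b] by (intro ennreal_plus integral_nonneg_AE) auto
  also have "ennreal (LINT w|lborel. ?l w * r w) = (\<integral>\<^sup>+w. ?l w * r w \<partial>lborel)"
    using int nonneg laplace_density_nonneg[OF b] by (intro nn_integral_eq_integral[symmetric]) auto
  finally show ?thesis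
    by (simp add: a_def r_def)
qed

text \<open>The substitutions w = \<sigma> z and x = \<xi> + w, with Tonelli in between, expose the
  density of \<xi> + \<sigma> z weighted by \<open>H\<close> as a convolution. The deconvolution
  identity then applies to \<open>H\<close> proportional to \<open>accept\<close> or
  \<open>excess\<close>.\<close>

lemma nn_integral_laplace_normal:
  fixes H :: "real \<Rightarrow> real" and F :: "real \<Rightarrow> ennreal"
  assumes [measurable]: "H \<in> borel_measurable borel" "F \<in> borel_measurable borel"
    and H: "\<And>z. 0 \<le> H z" and b: "0 < b" and \<sigma>: "0 < \<sigma>"
  shows "(\<integral>\<^sup>+\<xi>. \<integral>\<^sup>+z. H z * F (\<xi> + \<sigma> * z) \<partial>std_normal_distribution \<partial>laplace b) =
    (\<integral>\<^sup>+x. F x * (\<integral>\<^sup>+w. laplace_density b (x - w) * (normal_density 0 \<sigma> w * H (w / \<sigma>)) \<partial>lborel) \<partial>lborel)"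
proof -
  let ?g = "\<lambda>w. ennreal (normal_density 0 \<sigma> w * H (w / \<sigma>))"
  have "(\<integral>\<^sup>+z. H z * F (\<xi> + \<sigma> * z) \<partial>std_normal_distribution) = (\<integral>\<^sup>+w. ?g w * F (\<xi> + w) \<partial>lborel)" for \<xi>
  proof -
    have "(\<integral>\<^sup>+w. ?g w * F (\<xi> + w) \<partial>lborel) = \<bar>\<sigma>\<bar> * (\<integral>\<^sup>+z. ?g (0 + \<sigma> * z) * F (\<xi> + (0 + \<sigma> * z)) \<partial>lborel)"
      using \<sigma> by (intro nn_integral_real_affine) auto
    also have "\<dots> = (\<integral>\<^sup>+z. \<sigma> * (?g (\<sigma> * z) * F (\<xi> + \<sigma> * z)) \<partial>lborel)"
      using \<sigma> by (simp add: nn_integral_cmult)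
    also have "\<dots> = (\<integral>\<^sup>+z. std_normal_density z * (H z * F (\<xi> + \<sigma> * z)) \<partial>lborel)"
    proof (intro nn_integral_cong)
      fix z
      have "ennreal \<sigma> * (?g (\<sigma> * z) * F (\<xi> + \<sigma> * z)) =
          ennreal (\<sigma> * normal_density 0 \<sigma> (\<sigma> * z)) * (H z * F (\<xi> + \<sigma> * z))"
        using \<sigma> H by (simp add: ennreal_mult mult.assoc)
      then show "ennreal \<sigma> * (?g (\<sigma> * z) * F (\<xi> + \<sigma> * z)) =
          std_normal_density z * (H z * F (\<xi> + \<sigma> * z))"
        by (simp only: normal_density_scale[OF \<sigma>])
    qed
    finally show ?thesis
      using nn_integral_std_normal[of "\<lambda>z. H z * F (\<xi> + \<sigma> * z)"] by simp
  qed
  then have "(\<integral>\<^sup>+\<xi>. \<integral>\<^sup>+z. H z * F (\<xi> + \<sigma> * z) \<partial>std_normal_distribution \<partial>laplace b) =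
      (\<integral>\<^sup>+\<xi>. \<integral>\<^sup>+w. laplace_density b \<xi> * (?g w * F (\<xi> + w)) \<partial>lborel \<partial>lborel)"
    by (subst nn_integral_laplace) (simp_all add: nn_integral_cmult)
  also have "\<dots> = (\<integral>\<^sup>+w. \<integral>\<^sup>+\<xi>. laplace_density b \<xi> * (?g w * F (\<xi> + w)) \<partial>lborel \<partial>lborel)"
    by (rule lborel_pair.Fubini') measurable
  also have "\<dots> = (\<integral>\<^sup>+w. \<integral>\<^sup>+x. laplace_density b (x - w) * (?g w * F x) \<partial>lborel \<partial>lborel)"
  proof (rule nn_integral_cong)
    fix w
    show "(\<integral>\<^sup>+\<xi>. laplace_density b \<xi> * (?g w * F (\<xi> + w)) \<partial>lborel) =
        (\<integral>\<^sup>+x. laplace_density b (x - w) * (?g w * F x) \<partial>lborel)"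
      by (subst nn_integral_real_affine[of _ 1 "- w"]) simp_all
  qed
  also have "\<dots> = (\<integral>\<^sup>+x. \<integral>\<^sup>+w. laplace_density b (x - w) * (?g w * F x) \<partial>lborel \<partial>lborel)"
    by (rule lborel_pair.Fubini'[symmetric]) measurable
  also have "\<dots> = (\<integral>\<^sup>+x. \<integral>\<^sup>+w. F x * ennreal (laplace_density b (x - w) * (normal_density 0 \<sigma> w * H (w / \<sigma>))) \<partial>lborel \<partial>lborel)"
  proof (intro nn_integral_cong)
    fix x w
    have "ennreal (laplace_density b (x - w) * (normal_density 0 \<sigma> w * H (w / \<sigma>))) =
        laplace_density b (x - w) * ?g w"
      using laplace_density_nonneg[OF b] by (rule ennreal_mult')
    then show "laplace_density b (x - w) * (?g w * F x) =
        F x * ennreal (laplace_density b (x - w) * (normal_density 0 \<sigma> w * H (w / \<sigma>)))"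
      by (simp only: mult_ac)
  qed
  also have "\<dots> = (\<integral>\<^sup>+x. F x * (\<integral>\<^sup>+w. laplace_density b (x - w) * (normal_density 0 \<sigma> w * H (w / \<sigma>)) \<partial>lborel) \<partial>lborel)"
    by (intro nn_integral_cong nn_integral_cmult) measurable
  finally show ?thesis .
qed

subsection \<open>Moments of the acceptance probability\<close>

text \<open>Beyond \<open>sqrt c\<close> the integrand is (z^2 - c) / (c - 1) times the density
  \<phi>. Replacing z^2 - c by z^2 - 1 makes it integrable in closed form, since (z^2 - 1) \<phi> is
  the derivative of - z \<phi>. The factor 2 counts both tails.\<close>

lemma nn_integral_excess_le:
  assumes c: "1 < c" and \<alpha>: "\<alpha> = c / (c - 1)"
  shows "(\<integral>\<^sup>+z. \<alpha> * excess c z \<partial>std_normal_distribution) \<le>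
    ennreal (2 * (sqrt c / (c - 1) * std_normal_density (sqrt c)))"
proof -
  define g where "g = (\<lambda>z. std_normal_density z * ((z\<^sup>2 - 1) / (c - 1)))"
  define F where "F = (\<lambda>z. - (z / (c - 1)) * std_normal_density z)"
  have [measurable]: "g \<in> borel_measurable borel"
    unfolding g_def by measurable
  have g_uminus: "g (- z) = g z" for z
    by (simp add: g_def normal_density_def)
  have tail: "(\<integral>\<^sup>+z. ennreal (g z) * indicator {sqrt c..} z \<partial>lborel) = ennreal (0 - F (sqrt c))"
  proof (rule nn_integral_FTC_atLeast)
    fix z assume z: "sqrt c \<le> z"
    have "1 \<le> sqrt c" using c by simp
    with z have "1 \<le> z" by linarith
    then show "0 \<le> g z"
      using c by (simp add: g_def one_le_power)
    have "((\<lambda>z. - (z / (c - 1))) has_real_derivative - (1 / (c - 1))) (at z)"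
      using c by (auto intro!: derivative_eq_intros)
    from DERIV_mult[OF this DERIV_normal_density[of 1 z]]
    have "(F has_real_derivative - (1 / (c - 1)) * std_normal_density z
        + - (z / 1\<^sup>2) * std_normal_density z * - (z / (c - 1))) (at z)"
      unfolding F_def by simp
    also have "- (1 / (c - 1)) * std_normal_density z
        + - (z / 1\<^sup>2) * std_normal_density z * - (z / (c - 1)) = g z"
      using c by (simp add: g_def divide_simps) (simp add: algebra_simps power2_eq_square)
    finally show "(F has_real_derivative g z) (at z)" .
  next
    show "(F \<longlongrightarrow> 0) at_top"
      unfolding F_def normal_density_def using c by real_asymp
  qed simp
  have "(\<integral>\<^sup>+z. \<alpha> * excess c z \<partial>std_normal_distribution) =
      (\<integral>\<^sup>+z. std_normal_density z * ennreal (\<alpha> * excess c z) \<partial>lborel)"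
    by (rule nn_integral_std_normal) measurable
  also have "\<dots> \<le> (\<integral>\<^sup>+z. ennreal (g z) * indicator {sqrt c..} z + ennreal (g (- z)) * indicator {sqrt c..} (- z) \<partial>lborel)"
  proof (rule nn_integral_mono)
    fix z :: real
    show "std_normal_density z * ennreal (\<alpha> * excess c z) \<le>
        ennreal (g z) * indicator {sqrt c..} z + ennreal (g (- z)) * indicator {sqrt c..} (- z)"
    proof (cases "c \<le> z\<^sup>2")
      case True
      then have "sqrt c \<le> \<bar>z\<bar>"
        by (simp add: real_le_rsqrt real_sqrt_le_iff flip: real_sqrt_abs)
      then have "z \<in> {sqrt c..} \<or> - z \<in> {sqrt c..}"
        by (auto simp: abs_if split: if_splits)
      moreover have "\<alpha> * excess c z \<le> (z\<^sup>2 - 1) / (c - 1)"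
        using True c by (simp add: excess_def \<alpha> max_def divide_simps)
      then have "std_normal_density z * (\<alpha> * excess c z) \<le> g z"
        unfolding g_def by (rule mult_left_mono) simp
      then have "std_normal_density z * ennreal (\<alpha> * excess c z) \<le> ennreal (g z)"
        by (subst ennreal_mult'[symmetric]) (auto intro!: ennreal_leI)
      ultimately show ?thesis
        by (auto simp: g_uminus split: split_indicator intro: add_increasing add_increasing2)
    next
      case False
      then have "excess c z = 0"
        using c by (simp add: excess_def)
      then show ?thesis by simp
    qed
  qed
  also have "\<dots> = (\<integral>\<^sup>+z. ennreal (g z) * indicator {sqrt c..} z \<partial>lborel) +
      (\<integral>\<^sup>+z. ennreal (g (- z)) * indicator {sqrt c..} (- z) \<partial>lborel)"
    by (rule nn_integral_add) measurable
  also have "(\<integral>\<^sup>+z. ennreal (g (- z)) * indicator {sqrt c..} (- z) \<partial>lborel) =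
      (\<integral>\<^sup>+z. ennreal (g z) * indicator {sqrt c..} z \<partial>lborel)"
    using nn_integral_real_affine[of "\<lambda>z. ennreal (g z) * indicator {sqrt c..} z" "- 1" 0] by simp
  also have "(\<integral>\<^sup>+z. ennreal (g z) * indicator {sqrt c..} z \<partial>lborel) +
      (\<integral>\<^sup>+z. ennreal (g z) * indicator {sqrt c..} z \<partial>lborel) =
      ennreal (2 * (sqrt c / (c - 1) * std_normal_density (sqrt c)))"
    unfolding tail using c by (subst ennreal_plus[symmetric]) (simp_all add: F_def)
  finally show ?thesis .
qed

text \<open>As z^2 has mean 1, \<alpha> (1 - z^2 / c) has mean \<alpha> (1 - 1 / c) = 1; the excess
  is what truncation adds.\<close>

lemma nn_integral_accept_eq:
  assumes c: "1 < c" and \<alpha>: "\<alpha> = c / (c - 1)"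
  shows "ennreal \<alpha> * (\<integral>\<^sup>+z. accept c z \<partial>std_normal_distribution) =
    1 + (\<integral>\<^sup>+z. \<alpha> * excess c z \<partial>std_normal_distribution)"
proof -
  let ?N = std_normal_distribution
  interpret N: prob_space ?N by (rule prob_space_std_normal)
  have \<alpha>_pos: "0 < \<alpha>" using c by (simp add: \<alpha>)
  define e where "e = 1 / (c - 1)"
  have e: "0 \<le> e" "\<alpha> = 1 + e" using c by (simp_all add: e_def \<alpha> field_simps)
  \<comment> \<open>The term e z^2, with e = \<alpha> / c, is added on both sides to avoid
    subtraction in \<open>ennreal\<close>; its mean \<open>e\<close> is cancelled at the
    end.\<close>
  have eq: "\<alpha> * accept c z + e * z\<^sup>2 = \<alpha> + \<alpha> * excess c z" for z
    using c by (simp add: accept_eq \<alpha> e_def divide_simps)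
  have "ennreal \<alpha> * (\<integral>\<^sup>+z. accept c z \<partial>?N) + ennreal e * (\<integral>\<^sup>+z. z\<^sup>2 \<partial>?N) =
      (\<integral>\<^sup>+z. ennreal (\<alpha> * accept c z + e * z\<^sup>2) \<partial>?N)"
    using e(1) \<alpha>_pos accept_bounds(1)
    by (simp add: ennreal_plus ennreal_mult nn_integral_add nn_integral_cmult)
  also have "\<dots> = ennreal \<alpha> + (\<integral>\<^sup>+z. \<alpha> * excess c z \<partial>?N)"
    unfolding eq using \<alpha>_pos excess_nonneg N.emeasure_space_1
    by (simp add: ennreal_plus nn_integral_add)
  also have "\<dots> = 1 + ennreal e + (\<integral>\<^sup>+z. \<alpha> * excess c z \<partial>?N)"
    using e by (simp add: ennreal_plus)
  finally have "ennreal e + ennreal \<alpha> * (\<integral>\<^sup>+z. accept c z \<partial>?N) =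
      ennreal e + (1 + (\<integral>\<^sup>+z. \<alpha> * excess c z \<partial>?N))"
    by (simp add: nn_integral_std_normal_square ac_simps)
  then show ?thesis
    by (simp add: ennreal_add_left_cancel)
qed

text \<open>Negative correlation: \<open>accept c\<close> decreases in \<open>z\<^sup>2\<close>, whose mean is \<open>1\<close>.\<close>

lemma nn_integral_square_accept_le:
  assumes c: "0 < c"
  shows "(\<integral>\<^sup>+z. accept c z * z\<^sup>2 \<partial>std_normal_distribution) \<le> (\<integral>\<^sup>+z. accept c z \<partial>std_normal_distribution)"
proof -
  let ?N = std_normal_distribution
  interpret N: prob_space ?N by (rule prob_space_std_normal)
  \<comment> \<open>Both factors of (accept c z - accept c 1) (1 - z^2) change sign at z^2 = 1, so
    the product is nonnegative. Because z^2 has mean 1, the two terms with \<open>accept c 1\<close>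
    cancel after integration.\<close>
  have le: "accept c z * z\<^sup>2 + accept c 1 \<le> accept c z + accept c 1 * z\<^sup>2" for z
  proof -
    have "0 \<le> (accept c z - accept c 1) * (1 - z\<^sup>2)"
    proof (cases "z\<^sup>2 \<le> 1")
      case True
      then have "z\<^sup>2 / c \<le> 1 / c" using c by (simp add: divide_right_mono)
      then have "accept c 1 \<le> accept c z" by (simp add: accept_def max_def)
      with True show ?thesis by simp
    next
      case False
      then have "1 / c \<le> z\<^sup>2 / c" using c by (simp add: divide_right_mono)
      then have "accept c z \<le> accept c 1" by (simp add: accept_def max_def)
      with False show ?thesis by (intro mult_nonpos_nonpos) auto
    qed
    then show ?thesis by (simp add: algebra_simps)
  qed
  have "(\<integral>\<^sup>+z. accept c z * z\<^sup>2 \<partial>?N) + ennreal (accept c 1) = (\<integral>\<^sup>+z. ennreal (accept c z * z\<^sup>2 + accept c 1) \<partial>?N)"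
    using accept_bounds(1) N.emeasure_space_1 by (simp add: ennreal_plus nn_integral_add)
  also have "\<dots> \<le> (\<integral>\<^sup>+z. ennreal (accept c z + accept c 1 * z\<^sup>2) \<partial>?N)"
    by (intro nn_integral_mono ennreal_leI le)
  also have "\<dots> = (\<integral>\<^sup>+z. accept c z \<partial>?N) + ennreal (accept c 1)"
    using accept_bounds(1)
    by (simp add: ennreal_plus ennreal_mult nn_integral_add nn_integral_cmult nn_integral_std_normal_square)
  finally show ?thesis
    by (simp add: ennreal_add_left_cancel_le add.commute[of _ "ennreal (accept c 1)"])
qed

text \<open>Both \<open>accept\<close> and the normal density are even, so averaging over z and - z
  removes the cross term; the remaining z^2 term is bounded by
  \<open>nn_integral_square_accept_le\<close>. The sign is the parameter of
  \<open>J\<close>.\<close>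

lemma nn_integral_accept_shift_square_le:
  assumes c: "0 < c"
  shows "(\<integral>\<^sup>+z. accept c z * ennreal ((x + \<sigma> * z)\<^sup>2) \<partial>std_normal_distribution) \<le>
    (\<integral>\<^sup>+z. accept c z \<partial>std_normal_distribution) * ennreal (x\<^sup>2 + \<sigma>\<^sup>2)"
proof -
  let ?N = std_normal_distribution
  define J where "J = (\<lambda>s. \<integral>\<^sup>+z. accept c z * ennreal ((x + s * (\<sigma> * z))\<^sup>2) \<partial>?N)"
  have "J 1 = J (- 1)"
  proof -
    have "J (- 1) = (\<integral>\<^sup>+z. std_normal_density z * (accept c z * ennreal ((x + - 1 * (\<sigma> * z))\<^sup>2)) \<partial>lborel)"
      unfolding J_def by (rule nn_integral_std_normal) measurable
    also have "\<dots> = (\<integral>\<^sup>+z. std_normal_density z * (accept c z * ennreal ((x + 1 * (\<sigma> * z))\<^sup>2)) \<partial>lborel)"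
      by (subst nn_integral_real_affine[of _ "- 1" 0]) (simp_all add: normal_density_def accept_def)
    also have "\<dots> = J 1"
      unfolding J_def by (rule nn_integral_std_normal[symmetric]) measurable
    finally show ?thesis ..
  qed
  then have "2 * J 1 = J 1 + J (- 1)"
    by (simp add: mult_2)
  also have "\<dots> = (\<integral>\<^sup>+z. accept c z * ennreal ((x + \<sigma> * z)\<^sup>2) + accept c z * ennreal ((x - \<sigma> * z)\<^sup>2) \<partial>?N)"
    unfolding J_def by (subst nn_integral_add) simp_all
  also have "\<dots> = (\<integral>\<^sup>+z. 2 * (accept c z * ennreal (x\<^sup>2) + ennreal (\<sigma>\<^sup>2) * ennreal (accept c z * z\<^sup>2)) \<partial>?N)"
  proof (intro nn_integral_cong)
    fix z
    have "accept c z * (x + \<sigma> * z)\<^sup>2 + accept c z * (x - \<sigma> * z)\<^sup>2 =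
        2 * (accept c z * x\<^sup>2 + \<sigma>\<^sup>2 * (accept c z * z\<^sup>2))"
      by (simp add: power2_eq_square algebra_simps)
    then have "ennreal (accept c z * (x + \<sigma> * z)\<^sup>2 + accept c z * (x - \<sigma> * z)\<^sup>2) =
        ennreal (2 * (accept c z * x\<^sup>2 + \<sigma>\<^sup>2 * (accept c z * z\<^sup>2)))"
      by simp
    then show "accept c z * ennreal ((x + \<sigma> * z)\<^sup>2) + accept c z * ennreal ((x - \<sigma> * z)\<^sup>2) =
        2 * (accept c z * ennreal (x\<^sup>2) + ennreal (\<sigma>\<^sup>2) * ennreal (accept c z * z\<^sup>2))"
      using accept_bounds(1)[of c z] by (simp add: ennreal_plus ennreal_mult)
  qed
  also have "\<dots> = 2 * ((\<integral>\<^sup>+z. accept c z \<partial>?N) * ennreal (x\<^sup>2) + ennreal (\<sigma>\<^sup>2) * (\<integral>\<^sup>+z. accept c z * z\<^sup>2 \<partial>?N))"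
    by (simp add: nn_integral_cmult nn_integral_add nn_integral_multc)
  also have "\<dots> \<le> 2 * ((\<integral>\<^sup>+z. accept c z \<partial>?N) * ennreal (x\<^sup>2) + ennreal (\<sigma>\<^sup>2) * (\<integral>\<^sup>+z. accept c z \<partial>?N))"
    by (intro mult_left_mono add_left_mono nn_integral_square_accept_le c) simp_all
  also have "\<dots> = 2 * ((\<integral>\<^sup>+z. accept c z \<partial>?N) * ennreal (x\<^sup>2 + \<sigma>\<^sup>2))"
    by (simp add: ennreal_plus algebra_simps)
  finally have "2 * J 1 \<le> 2 * ((\<integral>\<^sup>+z. accept c z \<partial>?N) * ennreal (x\<^sup>2 + \<sigma>\<^sup>2))" .
  then show ?thesis
    by (simp add: J_def ennreal_mult_le_mult_iff)
qed

subsection \<open>The law of the mechanism\<close>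

text \<open>The weights of \<open>nn_integral_rejection\<close> form a partition of probability:
  either all rounds reject, or the last acceptance is followed by \<open>i\<close>
  rejections.\<close>

lemma geometric_partition:
  fixes p q :: ennreal
  assumes "p + q = 1"
  shows "q ^ n + (\<Sum>i<n. q ^ i) * p = 1"
proof (induction n)
  case (Suc n)
  have "q ^ Suc n + (\<Sum>i<Suc n. q ^ i) * p = q ^ n * (p + q) + (\<Sum>i<n. q ^ i) * p"
    by (simp add: algebra_simps)
  with Suc assms show ?case by simp
qed simp

lemma measurable_result_kernel_prog:
  assumes "0 < \<delta>"
  shows "(\<lambda>(y, \<omega>). result kernel_prog [y, b, \<delta>] \<omega>) \<in> borel \<Otimes>\<^sub>M coins \<rightarrow>\<^sub>M borel"
proof -
  have "(\<lambda>x. (\<lambda>(w, u, z). rejection n c w u z) (0, fst (snd x), snd (snd x))) \<in> borel \<Otimes>\<^sub>M coins \<rightarrow>\<^sub>M borel" for n c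
    by measurable
  then have [measurable]: "(\<lambda>x. rejection n c 0 (fst (snd x)) (snd (snd x))) \<in> borel \<Otimes>\<^sub>M coins \<rightarrow>\<^sub>M borel" for n c
    by simp
  show ?thesis
    unfolding result_kernel_prog[OF assms] case_prod_beta by measurable
qed

definition round_fail :: "real \<Rightarrow> ennreal" where
  "round_fail c = (\<integral>\<^sup>+z. 1 - accept c z \<partial>std_normal_distribution)"

text \<open>The Markov kernel of the program applied to the test function \<open>F\<close>, in the
  closed form of \<open>nn_integral_rejection\<close> with initial value 0. The query and the
  database do not occur in it, which is what privacy rests on.\<close>

definition kernel_integral :: "real \<Rightarrow> real \<Rightarrow> (real \<Rightarrow> ennreal) \<Rightarrow> real \<Rightarrow> ennreal" where
  "kernel_integral b \<delta> F y =
     (let n = nat \<lceil>1 / \<delta>\<rceil>; c = 2 * ln (12 / \<delta>) + 1; q = round_fail c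
      in q ^ n * F y + (\<Sum>i<n. q ^ i) *
        (\<integral>\<^sup>+z. ennreal (accept c z) * F (y + b * sqrt (2 * ln (12 / \<delta>)) * z) \<partial>std_normal_distribution))"

lemma borel_measurable_kernel_integral:
  fixes F :: "real \<Rightarrow> ennreal"
  assumes [measurable]: "F \<in> borel_measurable borel"
  shows "kernel_integral b \<delta> F \<in> borel_measurable borel"
proof -
  interpret N: prob_space std_normal_distribution by (rule prob_space_std_normal)
  show ?thesis
    unfolding kernel_integral_def[abs_def] Let_def by measurable
qed

lemma nn_integral_result_law:
  fixes F :: "real \<Rightarrow> ennreal"
  assumes F [measurable]: "F \<in> borel_measurable borel"
    and \<delta>: "0 < \<delta>" "\<delta> < 1" and M [measurable_cong]: "sets M = sets borel"
  shows "(\<integral>\<^sup>+x. F x \<partial>result_law kernel_prog [b, \<delta>] M) = (\<integral>\<^sup>+y. kernel_integral b \<delta> F y \<partial>M)"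
proof -
  interpret C: prob_space coins by (rule prob_space_coins)
  have L: "0 < ln (12 / \<delta>)"
    using \<delta> by simp
  have meas: "(\<lambda>(y, \<omega>). result kernel_prog [y, b, \<delta>] \<omega>) \<in> M \<Otimes>\<^sub>M coins \<rightarrow>\<^sub>M borel"
    using measurable_result_kernel_prog[OF \<delta>(1), of b] by measurable
  have "(\<integral>\<^sup>+x. F x \<partial>result_law kernel_prog [b, \<delta>] M) =
      (\<integral>\<^sup>+x. F ((\<lambda>(y, \<omega>). result kernel_prog [y, b, \<delta>] \<omega>) x) \<partial>(M \<Otimes>\<^sub>M coins))"
    unfolding result_law_def by (rule nn_integral_distr[OF meas]) (simp add: F)
  also have "\<dots> = (\<integral>\<^sup>+y. \<integral>\<^sup>+\<omega>. F (result kernel_prog [y, b, \<delta>] \<omega>) \<partial>coins \<partial>M)"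
    by (subst C.nn_integral_fst[symmetric]) (simp_all add: measurable_compose[OF meas F])
  also have "\<dots> = (\<integral>\<^sup>+y. kernel_integral b \<delta> F y \<partial>M)"
  proof (rule nn_integral_cong)
    fix y
    show "(\<integral>\<^sup>+\<omega>. F (result kernel_prog [y, b, \<delta>] \<omega>) \<partial>coins) = kernel_integral b \<delta> F y"
      using nn_integral_rejection[of "\<lambda>w. F (y + b * sqrt (2 * ln (12 / \<delta>)) * w)"
          "2 * ln (12 / \<delta>) + 1" "nat \<lceil>1 / \<delta>\<rceil>" 0] L
      by (simp add: result_kernel_prog[OF \<delta>(1)] kernel_integral_def Let_def round_fail_def)
  qed
  finally show ?thesis .
qed

lemma nn_integral_mechanism:
  fixes F :: "real \<Rightarrow> ennreal"
  assumes F [measurable]: "F \<in> borel_measurable borel" and \<delta>: "0 < \<delta>" "\<delta> < 1"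
  shows "(\<integral>\<^sup>+x. F x \<partial>result_law kernel_prog [b, \<delta>] (add_noise f (laplace b) X)) =
    (\<integral>\<^sup>+\<xi>. kernel_integral b \<delta> F (f X + \<xi>) \<partial>laplace b)"
  using borel_measurable_kernel_integral[OF F]
  by (subst nn_integral_result_law[OF F \<delta>]) (simp_all add: add_noise_def nn_integral_distr)

lemma prob_space_mechanism:
  assumes "0 < b" "0 < \<delta>" "\<delta> < 1"
  shows "prob_space (result_law kernel_prog [b, \<delta>] (add_noise f (laplace b) X))"
proof -
  interpret L: prob_space "laplace b" by (rule prob_space_laplace) fact
  interpret C: prob_space coins by (rule prob_space_coins)
  interpret A: prob_space "add_noise f (laplace b) X"
    unfolding add_noise_def by (rule L.prob_space_distr) measurable
  interpret P: pair_prob_space "add_noise f (laplace b) X" coins ..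
  have [measurable_cong]: "sets (add_noise f (laplace b) X) = sets borel"
    by (simp add: add_noise_def)
  have "(\<lambda>(y, \<omega>). result kernel_prog [y, b, \<delta>] \<omega>) \<in> add_noise f (laplace b) X \<Otimes>\<^sub>M coins \<rightarrow>\<^sub>M borel"
    using measurable_result_kernel_prog[OF assms(2), of b] by measurable
  then show ?thesis
    unfolding result_law_def by (rule P.prob_space_distr)
qed

lemma sets_result_law [simp]: "sets (result_law P ps M) = sets borel"
  by (simp add: result_law_def)

section \<open>Bounds on the failure probability and on the excess mass\<close>

text \<open>A proposal is rejected with probability min 1 (z^2 / c), and z^2 has mean 1.\<close>

lemma round_fail_le:
  assumes "0 < c"
  shows "round_fail c \<le> ennreal (1 / c)"
proof -
  have "round_fail c \<le> (\<integral>\<^sup>+z. ennreal (1 / c) * ennreal (z\<^sup>2) \<partial>std_normal_distribution)"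
    unfolding round_fail_def using assms
    by (intro nn_integral_mono) (simp add: ennreal_mult[symmetric] accept_def max_def ennreal_leI)
  also have "\<dots> = ennreal (1 / c)"
    by (simp add: nn_integral_cmult nn_integral_std_normal_square)
  finally show ?thesis .
qed

text \<open>The constant 12 exceeds e^2, which makes \<open>c\<close> at least 5.\<close>

lemma two_le_ln:
  fixes \<delta> :: real
  assumes "0 < \<delta>" "\<delta> < 1"
  shows "2 \<le> ln (12 / \<delta>)"
proof -
  have "exp 2 = exp 1 * exp (1::real)"
    by (simp flip: exp_add)
  also have "\<dots> \<le> 3 * 3"
    by (intro mult_mono exp_le) simp_all
  also have "\<dots> \<le> 12 / \<delta>"
    using assms by (simp add: field_simps)
  finally show ?thesis
    using assms by (simp add: ln_ge_iff)
qed

text \<open>Bernoulli's inequality for 4 = 1 + 3 gives 4^n \<ge> 1 + 3 n \<ge> 3 / \<delta>.\<close>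

lemma round_fail_power_le:
  fixes \<delta> :: real
  assumes \<delta>: "0 < \<delta>" "\<delta> < 1" and c: "4 \<le> c"
  shows "round_fail c ^ nat \<lceil>1 / \<delta>\<rceil> \<le> ennreal (\<delta> / 3)"
proof -
  let ?n = "nat \<lceil>1 / \<delta>\<rceil>"
  have n: "1 / \<delta> \<le> real ?n"
    by (rule real_nat_ceiling_ge)
  have "3 / \<delta> \<le> 1 + real ?n * 3"
    using n by simp
  also have "\<dots> \<le> (1 + 3) ^ ?n"
    by (rule Bernoulli_inequality) simp
  finally have "3 / \<delta> \<le> 4 ^ ?n"
    by simp
  then have "(1 / 4) ^ ?n \<le> \<delta> / 3"
    using \<delta> by (simp add: power_one_over field_simps)
  moreover have "round_fail c \<le> ennreal (1 / 4)"
    using round_fail_le[of c] c by (auto intro: order_trans ennreal_leI simp: field_simps)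
  then have "round_fail c ^ ?n \<le> ennreal ((1 / 4) ^ ?n)"
    by (subst ennreal_power[symmetric]) (auto intro: power_mono)
  ultimately show ?thesis
    by (meson order_trans ennreal_leI)
qed

text \<open>Three estimates for the tail bound: \<open>sqrt c \<le> c - 1\<close> because L \<ge> 2,
  exp (- c / 2) \<le> exp (- L) = \<delta> / 12 because c = 2 L + 1, and 1 / sqrt (2 pi) \<le> 1 /
  2, which absorbs the factor 2 from the two tails.\<close>

lemma excess_mass_le:
  fixes \<delta> :: real
  assumes \<delta>: "0 < \<delta>" "\<delta> < 1" and c: "c = 2 * ln (12 / \<delta>) + 1" and \<alpha>: "\<alpha> = c / (c - 1)"
  shows "(\<integral>\<^sup>+z. \<alpha> * excess c z \<partial>std_normal_distribution) \<le> ennreal (\<delta> / 12)"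
proof -
  define L where "L = ln (12 / \<delta>)"
  have L: "2 \<le> L" "c = 2 * L + 1"
    using two_le_ln[OF \<delta>] by (simp_all add: L_def c)
  have "c \<le> (c - 1)\<^sup>2"
  proof -
    have "2 * L \<le> L * L" using L by (intro mult_right_mono) auto
    moreover have "(c - 1)\<^sup>2 = 4 * (L * L)" by (simp add: L(2) power2_eq_square)
    ultimately show ?thesis using L by linarith
  qed
  then have "sqrt c \<le> c - 1"
    using L by (intro real_le_lsqrt) auto
  then have 1: "sqrt c / (c - 1) \<le> 1"
    using L by simp
  have "exp (- c / 2) \<le> exp (- L)"
    using L by simp
  also have "\<dots> = \<delta> / 12"
    using \<delta> by (simp add: L_def exp_minus)
  finally have 2: "exp (- c / 2) \<le> \<delta> / 12" .
  have "2 \<le> sqrt (2 * pi)"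
    using pi_ge_two by (intro real_le_rsqrt) simp
  then have "1 / sqrt (2 * pi) \<le> 1 / 2"
    by (intro divide_left_mono) simp_all
  then have "std_normal_density (sqrt c) \<le> 1 / 2 * (\<delta> / 12)"
    unfolding std_normal_density_def using 2 L \<delta> by (intro mult_mono) auto
  then have "sqrt c / (c - 1) * std_normal_density (sqrt c) \<le> 1 * (1 / 2 * (\<delta> / 12))"
    using 1 L by (intro mult_mono) auto
  then have "2 * (sqrt c / (c - 1) * std_normal_density (sqrt c)) \<le> \<delta> / 12"
    by linarith
  moreover have "1 < c"
    using L by linarith
  ultimately show ?thesis
    using nn_integral_excess_le[OF _ \<alpha>] by (meson order_trans ennreal_leI)
qed

subsection \<open>Total variation, privacy and accuracy\<close>

text \<open>With failure probability \<open>q\<close> the output is \<open>a\<close>, otherwise it is distributed as \<open>(g + i) / (1 + m)\<close>,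
  which differs from \<open>g\<close> by at most \<open>m\<close>.\<close>

lemma mixture_distance_real:
  fixes a d g i m p q s \<alpha> :: real
  assumes eqs: "q + s * p = 1" "\<alpha> * d = g + i" "\<alpha> * p = 1 + m"
    and bounds: "0 \<le> i" "i \<le> m" "0 \<le> a" "a \<le> 1" "0 \<le> g" "g \<le> 1" "0 \<le> q" "q \<le> 1" "0 < \<alpha>"
  shows "\<bar>q * a + s * d - g\<bar> \<le> q + m"
proof -
  define J where "J = (g + i) / (1 + m)"
  have m: "0 \<le> m" using bounds by linarith
  have "s * (1 + m) = \<alpha> * (1 - q)"
    using eqs by (metis add_diff_cancel_left' mult.left_commute)
  then have s: "s = \<alpha> * (1 - q) / (1 + m)"
    using m by (simp add: field_simps)
  have "s * d = (1 - q) * J"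
    unfolding J_def eqs(2)[symmetric] s by simp
  then have eq: "q * a + s * d - g = q * (a - J) + (J - g)"
    by (simp add: algebra_simps)
  have "g + i \<le> 1 + m"
    using bounds by linarith
  then have J: "0 \<le> J" "J \<le> 1"
    using bounds m by (simp_all add: J_def divide_simps)
  \<comment> \<open>Prepares bounds on the numerator of J - g = (i - m g) / (1 + m).\<close>
  have "m * g \<le> m * 1" "0 \<le> m * m" "0 \<le> m * g"
    using m bounds by (intro mult_left_mono mult_nonneg_nonneg; simp)+
  then have "i - m * g \<le> m * (1 + m)" "- (m * (1 + m)) \<le> i - m * g"
    unfolding distrib_left using bounds m by linarith+
  moreover have "J - g = (i - m * g) / (1 + m)"
    using m by (simp add: J_def field_simps)
  ultimately have "J - g \<le> m" "- m \<le> J - g"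
    using m by (simp_all add: pos_divide_le_eq pos_le_divide_eq)
  moreover have "q * (a - J) \<le> q * 1" "q * (J - a) \<le> q * 1"
    using J bounds by (intro mult_left_mono; simp)+
  ultimately show ?thesis
    unfolding eq by (simp add: abs_le_iff algebra_simps)
qed

text \<open>Transfers \<open>mixture_distance_real\<close> to \<open>ennreal\<close>; the work is to
  see that all quantities are finite.\<close>

lemma mixture_distance:
  fixes A D G I M p Q S :: ennreal
  assumes eqs: "Q + S * p = 1" "ennreal \<alpha> * D = G + I" "ennreal \<alpha> * p = 1 + M"
    and bounds: "I \<le> M" "A \<le> 1" "G \<le> 1" "Q + M \<le> ennreal e" "0 < \<alpha>" "0 \<le> e"
  shows "\<bar>enn2real (Q * A + S * D) - enn2real G\<bar> \<le> e"
proof -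
  have fin: "A \<noteq> \<top>" "G \<noteq> \<top>" "M \<noteq> \<top>" "Q \<noteq> \<top>"
    using bounds by (auto simp: top_unique)
  then have "I \<noteq> \<top>"
    using bounds by (auto simp: top_unique)
  with fin have "ennreal \<alpha> * D \<noteq> \<top>" "ennreal \<alpha> * p \<noteq> \<top>" "ennreal \<alpha> * p \<noteq> 0"
    unfolding eqs by auto
  with bounds have fin': "D \<noteq> \<top>" "p \<noteq> \<top>" "p \<noteq> 0"
    by (auto simp: ennreal_mult_eq_top_iff)
  \<comment> \<open>An infinite \<open>S\<close> times the nonzero \<open>p\<close> would be
    infinite, but \<open>Q + S * p\<close> is 1.\<close>
  with eqs(1) have "S \<noteq> \<top>"
    by (auto simp: ennreal_top_mult)
  have real_rep: "\<exists>x'. x = ennreal x' \<and> 0 \<le> x'" if "x \<noteq> \<top>" for x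
    using that by (cases x) auto
  obtain a g m q where
    r1: "A = ennreal a" "G = ennreal g" "M = ennreal m" "Q = ennreal q"
    and nonneg1: "0 \<le> a" "0 \<le> g" "0 \<le> m" "0 \<le> q"
    using fin[THEN real_rep] by blast
  obtain i d p' s where
    r2: "I = ennreal i" "D = ennreal d" "p = ennreal p'" "S = ennreal s"
    and nonneg2: "0 \<le> i" "0 \<le> d" "0 \<le> p'" "0 \<le> s"
    using real_rep[OF \<open>I \<noteq> \<top>\<close>] real_rep[OF fin'(1)] real_rep[OF fin'(2)] real_rep[OF \<open>S \<noteq> \<top>\<close>]
    by blast
  note r = r1 r2 and nonneg = nonneg1 nonneg2
  have "ennreal (q + s * p') = ennreal 1" "ennreal (\<alpha> * d) = ennreal (g + i)"
    "ennreal (\<alpha> * p') = ennreal (1 + m)"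
    using eqs nonneg bounds by (simp_all add: r ennreal_mult ennreal_plus)
  then have real: "q + s * p' = 1" "\<alpha> * d = g + i" "\<alpha> * p' = 1 + m"
    using nonneg bounds by (simp_all add: ennreal_inj del: ennreal_1 ennreal_plus)
  have "ennreal (q + m) \<le> ennreal e"
    using bounds nonneg by (simp add: r ennreal_plus)
  then have "q + m \<le> e"
    using bounds by (simp add: ennreal_le_iff del: ennreal_plus)
  moreover have "q \<le> 1"
    using real(1) nonneg by (smt (verit) mult_nonneg_nonneg)
  then have "\<bar>q * a + s * d - g\<bar> \<le> q + m"
    using bounds nonneg by (intro mixture_distance_real[OF real]) (simp_all add: r)
  moreover have "enn2real (Q * A + S * D) = q * a + s * d"
    using nonneg by (simp add: r ennreal_mult[symmetric] ennreal_plus[symmetric] del: ennreal_plus)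
  ultimately show ?thesis
    using nonneg by (simp add: r)
qed

lemma emeasure_gaussian_noise:
  assumes [measurable]: "B \<in> sets borel" and \<sigma>: "0 < \<sigma>"
  shows "emeasure (add_noise f (gaussian (\<sigma>\<^sup>2)) X) B =
    (\<integral>\<^sup>+x. ennreal (normal_density 0 \<sigma> x) * indicator B (f X + x) \<partial>lborel)"
proof -
  have "emeasure (add_noise f (gaussian (\<sigma>\<^sup>2)) X) B = (\<integral>\<^sup>+x. indicator B x \<partial>add_noise f (gaussian (\<sigma>\<^sup>2)) X)"
    by (simp add: add_noise_def)
  also have "\<dots> = (\<integral>\<^sup>+x. indicator B (f X + x) \<partial>gaussian (\<sigma>\<^sup>2))"
    unfolding add_noise_def by (rule nn_integral_distr) (simp_all add: gaussian_def)
  also have "\<dots> = (\<integral>\<^sup>+x. ennreal (normal_density 0 \<sigma> x) * indicator B (f X + x) \<partial>lborel)"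
    unfolding gaussian_def using \<sigma> by (subst nn_integral_density) simp_all
  finally show ?thesis .
qed

lemma prob_space_gaussian_noise:
  assumes "0 < v"
  shows "prob_space (add_noise f (gaussian v) X)"
proof -
  interpret prob_space "gaussian v"
    unfolding gaussian_def using assms by (intro prob_space_normal_density) simp
  show ?thesis
    unfolding add_noise_def by (rule prob_space_distr) (simp add: gaussian_def)
qed

text \<open>An instance of \<open>mixture_distance\<close>: \<open>A\<close> is the probability of
  \<open>B\<close> when every round fails, \<open>D\<close> the unnormalised one after an
  acceptance, \<open>G\<close> the normal target and \<open>I\<close> the contribution of the
  excess. The query value is absorbed into the test function \<open>F\<close>.\<close>

lemma measure_mechanism_diff_le:
  assumes b: "0 < b" and \<delta>: "0 < \<delta>" "\<delta> < 1" and B [measurable]: "B \<in> sets borel"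
  shows "\<bar>measure (result_law kernel_prog [b, \<delta>] (add_noise f (laplace b) X)) B -
    measure (add_noise f (gaussian (2 * b\<^sup>2 * ln (12 / \<delta>))) X) B\<bar> \<le> \<delta>"
proof -
  let ?h = "result_law kernel_prog [b, \<delta>] (add_noise f (laplace b) X)"
  let ?N = std_normal_distribution
  define c where "c = 2 * ln (12 / \<delta>) + 1"
  define \<sigma> where "\<sigma> = b * sqrt (c - 1)"
  define \<alpha> where "\<alpha> = c / (c - 1)"
  define n where "n = nat \<lceil>1 / \<delta>\<rceil>"
  define q where "q = round_fail c"
  define F :: "real \<Rightarrow> ennreal" where "F = (\<lambda>x. indicator B (f X + x))"
  define r :: "real \<Rightarrow> ennreal" where
    "r = (\<lambda>x. \<integral>\<^sup>+w. laplace_density b (x - w) * (normal_density 0 \<sigma> w * (\<alpha> * excess c (w / \<sigma>))) \<partial>lborel)"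
  define A where "A = (\<integral>\<^sup>+\<xi>. F \<xi> \<partial>laplace b)"
  define D where "D = (\<integral>\<^sup>+\<xi>. \<integral>\<^sup>+z. accept c z * F (\<xi> + \<sigma> * z) \<partial>?N \<partial>laplace b)"
  define G where "G = emeasure (add_noise f (gaussian (2 * b\<^sup>2 * ln (12 / \<delta>))) X) B"
  define I where "I = (\<integral>\<^sup>+\<xi>. \<integral>\<^sup>+z. ennreal (\<alpha> * excess c z) * F (\<xi> + \<sigma> * z) \<partial>?N \<partial>laplace b)"
  define M where "M = (\<integral>\<^sup>+z. \<alpha> * excess c z \<partial>?N)"
  define p where "p = (\<integral>\<^sup>+z. accept c z \<partial>?N)"
  interpret L: prob_space "laplace b" by (rule prob_space_laplace) fact
  interpret N: prob_space ?N by (rule prob_space_std_normal)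
  have [measurable]: "F \<in> borel_measurable borel" unfolding F_def by measurable
  have [measurable]: "r \<in> borel_measurable borel" unfolding r_def by measurable
  have F_le: "F x \<le> 1" for x
    by (simp add: F_def indicator_def)
  have c: "5 \<le> c" "c - 1 = 2 * ln (12 / \<delta>)"
    using two_le_ln[OF \<delta>] by (simp_all add: c_def)
  have pos: "0 < \<sigma>" "0 < \<alpha>"
    using b c(1) by (simp_all add: \<sigma>_def \<alpha>_def)
  have "emeasure ?h B = (\<integral>\<^sup>+x. indicator B x \<partial>?h)"
    by simp
  also have "\<dots> = (\<integral>\<^sup>+\<xi>. kernel_integral b \<delta> (indicator B) (f X + \<xi>) \<partial>laplace b)"
    by (rule nn_integral_mechanism) (use \<delta> in simp_all)
  also have "\<dots> = (\<integral>\<^sup>+\<xi>. q ^ n * F \<xi> + (\<Sum>i<n. q ^ i) * (\<integral>\<^sup>+z. accept c z * F (\<xi> + \<sigma> * z) \<partial>?N) \<partial>laplace b)"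
    by (simp add: kernel_integral_def Let_def q_def n_def c_def F_def \<sigma>_def add.assoc)
  also have "\<dots> = q ^ n * A + (\<Sum>i<n. q ^ i) * D"
    unfolding A_def D_def by (simp add: nn_integral_add nn_integral_cmult)
  finally have H: "emeasure ?h B = q ^ n * A + (\<Sum>i<n. q ^ i) * D" .
  have "2 * b\<^sup>2 * ln (12 / \<delta>) = \<sigma>\<^sup>2"
    using c by (simp add: \<sigma>_def power_mult_distrib)
  then have G_eq: "G = (\<integral>\<^sup>+x. F x * normal_density 0 \<sigma> x \<partial>lborel)"
    by (simp add: G_def F_def emeasure_gaussian_noise pos mult.commute)
  \<comment> \<open>Laplace noise plus a proposal weighted by \<alpha> \<open>accept\<close> has the
    normal density plus the smoothed excess \<open>r\<close>.\<close>
  have "ennreal \<alpha> * D = (\<integral>\<^sup>+\<xi>. \<integral>\<^sup>+z. ennreal (\<alpha> * accept c z) * F (\<xi> + \<sigma> * z) \<partial>?N \<partial>laplace b)"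
    unfolding D_def using pos accept_bounds(1)
    by (simp add: nn_integral_cmult[symmetric] ennreal_mult mult.assoc)
  also have "\<dots> = (\<integral>\<^sup>+x. F x * (normal_density 0 \<sigma> x + r x) \<partial>lborel)"
    using pos b c(1) accept_bounds(1)
    by (subst nn_integral_laplace_normal)
       (simp_all add: r_def nn_integral_laplace_accept[OF b _ \<sigma>_def \<alpha>_def])
  also have "\<dots> = G + (\<integral>\<^sup>+x. F x * r x \<partial>lborel)"
    by (simp add: G_eq nn_integral_add distrib_left)
  also have "(\<integral>\<^sup>+x. F x * r x \<partial>lborel) = I"
    unfolding I_def r_def using pos b excess_nonneg
    by (subst nn_integral_laplace_normal) simp_all
  finally have D: "ennreal \<alpha> * D = G + I" .
  have pq: "p + q = 1"
    unfolding p_def q_def round_fail_def using c(1) by (intro nn_integral_accept_complement) simp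
  have "I \<le> (\<integral>\<^sup>+\<xi>. M \<partial>laplace b)"
    unfolding I_def M_def using mult_left_mono[OF F_le] by (intro nn_integral_mono) simp
  then have I: "I \<le> M"
    using L.emeasure_space_1 by simp
  have "A \<le> (\<integral>\<^sup>+\<xi>. 1 \<partial>laplace b)"
    unfolding A_def by (intro nn_integral_mono F_le)
  then have A: "A \<le> 1"
    using L.emeasure_space_1 by simp
  interpret G: prob_space "add_noise f (gaussian (2 * b\<^sup>2 * ln (12 / \<delta>))) X"
    using b c by (intro prob_space_gaussian_noise) simp
  \<comment> \<open>The error budget: \<delta> / 3 for failure of all rounds and \<delta> / 12 for
    the excess mass.\<close>
  have "q ^ n + M \<le> ennreal (\<delta> / 3) + ennreal (\<delta> / 12)"
    unfolding q_def n_def M_def using c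
    by (intro add_mono round_fail_power_le excess_mass_le) (simp_all add: \<delta> c_def \<alpha>_def)
  also have "\<dots> \<le> ennreal \<delta>"
    using \<delta> by (subst ennreal_plus[symmetric]) (auto intro: ennreal_leI)
  finally have "\<bar>enn2real (q ^ n * A + (\<Sum>i<n. q ^ i) * D) - enn2real G\<bar> \<le> \<delta>"
    using \<delta> c(1) geometric_partition[OF pq] D I A pos nn_integral_accept_eq[OF _ \<alpha>_def]
    by (intro mixture_distance[where p = p and M = M and \<alpha> = \<alpha>]) (simp_all add: G_def M_def p_def G.emeasure_le_1)
  then show ?thesis
    by (simp add: H[symmetric] G_def measure_def)
qed

lemma total_variation_mechanism:
  assumes "0 < b" "0 < \<delta>" "\<delta> < 1"
  shows "total_variation (result_law kernel_prog [b, \<delta>] (add_noise f (laplace b) X))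
    (add_noise f (gaussian (2 * b\<^sup>2 * ln (12 / \<delta>))) X) \<le> \<delta>"
  unfolding total_variation_def
  by (rule cSUP_least) (auto intro: measure_mechanism_diff_le[OF assms])

section \<open>Privacy as post-processing of the Laplace mechanism\<close>

lemma laplace_density_shift_le:
  assumes "0 < b" "\<bar>t - t'\<bar> \<le> s"
  shows "laplace_density b (x - t) \<le> exp (s / b) * laplace_density b (x - t')"
proof -
  have "- \<bar>x - t\<bar> \<le> s - \<bar>x - t'\<bar>"
    using assms(2) by linarith
  then have "- \<bar>x - t\<bar> / b \<le> s / b + - \<bar>x - t'\<bar> / b"
    using assms(1) by (simp add: divide_simps)
  then have "exp (- \<bar>x - t\<bar> / b) \<le> exp (s / b) * exp (- \<bar>x - t'\<bar> / b)"
    by (simp flip: exp_add)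
  then show ?thesis
    using assms(1) by (simp add: laplace_density_def divide_simps)
qed

text \<open>After the substitution y = f X + \<xi> the database enters only through the Laplace
  density at y - f X, while the output kernel \<open>k\<close> is the same for \<open>X\<close> and
  \<open>Y\<close>. The pointwise ratio of the densities therefore passes to the output
  probabilities.\<close>

lemma emeasure_mechanism_le:
  assumes b: "0 < b" and \<delta>: "0 < \<delta>" "\<delta> < 1" and B [measurable]: "B \<in> sets borel"
    and s: "\<bar>f X - f Y\<bar> \<le> s"
  shows "emeasure (result_law kernel_prog [b, \<delta>] (add_noise f (laplace b) X)) B \<le>
    ennreal (exp (s / b)) * emeasure (result_law kernel_prog [b, \<delta>] (add_noise f (laplace b) Y)) B"
proof -
  define k where "k = kernel_integral b \<delta> (indicator B)"
  have [measurable]: "k \<in> borel_measurable borel"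
    unfolding k_def by (rule borel_measurable_kernel_integral) measurable
  have eq: "emeasure (result_law kernel_prog [b, \<delta>] (add_noise f (laplace b) X)) B =
      (\<integral>\<^sup>+y. laplace_density b (y - f X) * k y \<partial>lborel)" for X
  proof -
    have "emeasure (result_law kernel_prog [b, \<delta>] (add_noise f (laplace b) X)) B =
        (\<integral>\<^sup>+x. indicator B x \<partial>result_law kernel_prog [b, \<delta>] (add_noise f (laplace b) X))"
      by simp
    also have "\<dots> = (\<integral>\<^sup>+\<xi>. k (f X + \<xi>) \<partial>laplace b)"
      unfolding k_def by (rule nn_integral_mechanism) (use \<delta> in simp_all)
    also have "\<dots> = (\<integral>\<^sup>+\<xi>. laplace_density b \<xi> * k (f X + \<xi>) \<partial>lborel)"
      by (rule nn_integral_laplace) measurable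
    also have "\<dots> = (\<integral>\<^sup>+y. laplace_density b (y - f X) * k y \<partial>lborel)"
      by (subst nn_integral_real_affine[of _ 1 "- f X"]) simp_all
    finally show ?thesis .
  qed
  have "(\<integral>\<^sup>+y. laplace_density b (y - f X) * k y \<partial>lborel) \<le>
      (\<integral>\<^sup>+y. ennreal (exp (s / b)) * (laplace_density b (y - f Y) * k y) \<partial>lborel)"
  proof (rule nn_integral_mono)
    fix y
    have "ennreal (laplace_density b (y - f X)) \<le> ennreal (exp (s / b) * laplace_density b (y - f Y))"
      by (intro ennreal_leI laplace_density_shift_le b s)
    then have "ennreal (laplace_density b (y - f X)) \<le> ennreal (exp (s / b)) * laplace_density b (y - f Y)"
      by (simp add: ennreal_mult')
    then show "laplace_density b (y - f X) * k y \<le> ennreal (exp (s / b)) * (laplace_density b (y - f Y) * k y)"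
      unfolding mult.assoc[symmetric] by (rule mult_right_mono) simp
  qed
  then show ?thesis
    by (simp add: eq nn_integral_cmult)
qed

lemma differentially_private_mechanism:
  assumes b: "0 < b" and \<delta>: "0 < \<delta>" "\<delta> < 1" and fin: "finite_sensitivity U n f"
  shows "differentially_private U n (sensitivity U n f / b) 0
    (\<lambda>X. result_law kernel_prog [b, \<delta>] (add_noise f (laplace b) X))"
  unfolding differentially_private_def mechanism_def
proof (intro conjI ballI)
  let ?h = "\<lambda>X. result_law kernel_prog [b, \<delta>] (add_noise f (laplace b) X)"
  fix X
  show "prob_space (?h X)" by (rule prob_space_mechanism[OF b \<delta>])
  show "sets (?h X) = sets borel" by simp
next
  let ?h = "\<lambda>X. result_law kernel_prog [b, \<delta>] (add_noise f (laplace b) X)"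
  fix XY assume XY: "XY \<in> neighbors U n"
  obtain X Y where [simp]: "XY = (X, Y)" by (cases XY)
  have "measure (?h X) B \<le> exp (sensitivity U n f / b) * measure (?h Y) B" if "B \<in> sets borel" for B
  proof -
    interpret X: prob_space "?h X" by (rule prob_space_mechanism[OF b \<delta>])
    interpret Y: prob_space "?h Y" by (rule prob_space_mechanism[OF b \<delta>])
    have "\<bar>f X - f Y\<bar> \<le> sensitivity U n f"
      using cSUP_upper[OF XY fin[unfolded finite_sensitivity_def]] by (simp add: sensitivity_def)
    from emeasure_mechanism_le[OF b \<delta> that this] show ?thesis
      by (simp add: X.emeasure_eq_measure Y.emeasure_eq_measure ennreal_mult'[symmetric] ennreal_le_iff)
  qed
  then show "case XY of (X, Y) \<Rightarrow> \<forall>B\<in>sets borel.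
      measure (?h X) B \<le> exp (sensitivity U n f / b) * measure (?h Y) B + 0"
    by simp
qed

section \<open>The mean square error\<close>

text \<open>Given \<xi>, total failure has squared error \<xi>^2, enlarged to \<xi>^2 + \<sigma>^2
  to match the bound after an acceptance. The weights then sum to 1 by
  \<open>geometric_partition\<close>, and \<xi>^2 has mean 2 b^2.\<close>

lemma nn_integral_square_error_le:
  assumes b: "0 < b" and \<delta>: "0 < \<delta>" "\<delta> < 1"
  shows "(\<integral>\<^sup>+v. ennreal ((v - f X)\<^sup>2) \<partial>result_law kernel_prog [b, \<delta>] (add_noise f (laplace b) X)) \<le>
    ennreal (2 * b\<^sup>2 * ln (12 / \<delta>) + 2 * b\<^sup>2)"
proof -
  let ?N = std_normal_distribution
  define c where "c = 2 * ln (12 / \<delta>) + 1"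
  define \<sigma> where "\<sigma> = b * sqrt (2 * ln (12 / \<delta>))"
  define n where "n = nat \<lceil>1 / \<delta>\<rceil>"
  define q where "q = round_fail c"
  define p where "p = (\<integral>\<^sup>+z. accept c z \<partial>?N)"
  interpret L: prob_space "laplace b" by (rule prob_space_laplace) fact
  have L: "2 \<le> ln (12 / \<delta>)"
    using two_le_ln[OF \<delta>] .
  have c: "0 < c" using L by (simp add: c_def)
  have pq: "p + q = 1"
    unfolding p_def q_def round_fail_def using c by (intro nn_integral_accept_complement) simp
  have \<sigma>2: "\<sigma>\<^sup>2 = 2 * b\<^sup>2 * ln (12 / \<delta>)"
    using L by (simp add: \<sigma>_def power_mult_distrib)
  have "(\<integral>\<^sup>+v. ennreal ((v - f X)\<^sup>2) \<partial>result_law kernel_prog [b, \<delta>] (add_noise f (laplace b) X)) =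
      (\<integral>\<^sup>+\<xi>. kernel_integral b \<delta> (\<lambda>v. ennreal ((v - f X)\<^sup>2)) (f X + \<xi>) \<partial>laplace b)"
    by (rule nn_integral_mechanism) (use \<delta> in simp_all)
  also have "\<dots> = (\<integral>\<^sup>+\<xi>. q ^ n * ennreal (\<xi>\<^sup>2) + (\<Sum>i<n. q ^ i) *
      (\<integral>\<^sup>+z. accept c z * ennreal ((\<xi> + \<sigma> * z)\<^sup>2) \<partial>?N) \<partial>laplace b)"
    by (simp add: kernel_integral_def Let_def q_def n_def c_def \<sigma>_def add.assoc)
  also have "\<dots> \<le> (\<integral>\<^sup>+\<xi>. q ^ n * ennreal (\<xi>\<^sup>2 + \<sigma>\<^sup>2) + (\<Sum>i<n. q ^ i) * (p * ennreal (\<xi>\<^sup>2 + \<sigma>\<^sup>2)) \<partial>laplace b)"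
    unfolding p_def using c
    by (intro nn_integral_mono add_mono mult_left_mono nn_integral_accept_shift_square_le ennreal_leI) simp_all
  also have "\<dots> = (\<integral>\<^sup>+\<xi>. (q ^ n + (\<Sum>i<n. q ^ i) * p) * ennreal (\<xi>\<^sup>2 + \<sigma>\<^sup>2) \<partial>laplace b)"
    by (simp only: distrib_right mult.assoc)
  also have "\<dots> = (\<integral>\<^sup>+\<xi>. ennreal (\<xi>\<^sup>2) + ennreal (\<sigma>\<^sup>2) \<partial>laplace b)"
    by (simp add: geometric_partition[OF pq] ennreal_plus)
  also have "\<dots> = ennreal (2 * b\<^sup>2) + ennreal (\<sigma>\<^sup>2)"
    using nn_integral_laplace_even_moment[OF b, of 2] L.emeasure_space_1 by (simp add: nn_integral_add fact_2)
  also have "\<dots> = ennreal (2 * b\<^sup>2 * ln (12 / \<delta>) + 2 * b\<^sup>2)"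
    unfolding \<sigma>2[symmetric] by (subst ennreal_plus[symmetric]) (simp_all add: add.commute)
  finally show ?thesis .
qed

lemma accuracy_mechanism_le:
  assumes b: "0 < b" and \<delta>: "0 < \<delta>" "\<delta> < 1"
  shows "accuracy U n (\<lambda>X. result_law kernel_prog [b, \<delta>] (add_noise f (laplace b) X)) f \<le>
    ennreal (sqrt (2 * b\<^sup>2 * ln (12 / \<delta>) + 2 * b\<^sup>2))"
  unfolding accuracy_def
proof (rule SUP_least)
  fix X
  let ?h = "result_law kernel_prog [b, \<delta>] (add_noise f (laplace b) X)"
  let ?V = "2 * b\<^sup>2 * ln (12 / \<delta>) + 2 * b\<^sup>2"
  have V: "0 \<le> ?V"
    using two_le_ln[OF \<delta>] by simp
  have le: "(\<integral>\<^sup>+v. ennreal ((v - f X)\<^sup>2) \<partial>?h) \<le> ennreal ?V"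
    by (rule nn_integral_square_error_le[OF b \<delta>])
  have [measurable_cong]: "sets ?h = sets borel" by simp
  \<comment> \<open>Integrability excludes the infinite branch of \<open>rmse\<close>.\<close>
  have int: "integrable ?h (\<lambda>v. (v - f X)\<^sup>2)"
    using le by (intro integrableI_bounded) (auto simp: top_unique intro: le_less_trans)
  have "ennreal (LINT v|?h. (v - f X)\<^sup>2) \<le> ennreal ?V"
    using le by (subst nn_integral_eq_integral[OF int, symmetric]) simp_all
  then have "(LINT v|?h. (v - f X)\<^sup>2) \<le> ?V"
    using V by (simp add: ennreal_le_iff)
  then show "rmse ?h (f X) \<le> ennreal (sqrt ?V)"
    using int by (simp add: rmse_def ennreal_leI)
qed

text \<open>Program and time polynomial are chosen before b, \<delta> and the query, so one uniform
  algorithm serves all cases. The law of h is formed by \<open>result_law\<close> from the law of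
  g(X) and the numbers b, \<delta>, which expresses that h has no access to f or X.\<close>

theorem corollary3:
  shows "\<exists>(P :: prog) (p :: real poly). \<forall>(b :: real) (\<delta> :: real).
    0 < b \<longrightarrow> 0 < \<delta> \<longrightarrow> \<delta> < 1 \<longrightarrow>
      (\<forall>y. halts_within P [y, b, \<delta>] (poly p (1 / \<delta>))) \<and>
      (\<forall>(U :: 'x set) (n :: nat) (f :: 'x list \<Rightarrow> real). finite_sensitivity U n f \<longrightarrow>
        (let g = add_noise f (laplace b);
             h = (\<lambda>X. result_law P [b, \<delta>] (g X))
         in (\<forall>X\<in>databases U n.
               total_variation (h X) (add_noise f (gaussian (2 * b\<^sup>2 * ln (12 / \<delta>))) X) \<le> \<delta>) \<and>
            differentially_private U n (sensitivity U n f / b) 0 h \<and>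
            accuracy U n h f \<le>
              ennreal (sqrt (2 * b\<^sup>2 * ln (12 / \<delta>) + 2 * b\<^sup>2
                + b\<^sup>2 / 4 * \<delta> * ln (12 / \<delta>) powr (3 / 2)))))"
proof (intro exI allI impI conjI)
  fix b \<delta> y :: real
  assume b: "0 < b" and \<delta>: "0 < \<delta>" "\<delta> < 1"
  show "halts_within kernel_prog [y, b, \<delta>] (poly [:70, 40:] (1 / \<delta>))"
    by (rule halts_within_kernel_prog[OF \<delta>(1)])
next
  fix b \<delta> :: real and U :: "'x set" and n and f :: "'x list \<Rightarrow> real"
  assume b: "0 < b" and \<delta>: "0 < \<delta>" "\<delta> < 1" and fin: "finite_sensitivity U n f"
  \<comment> \<open>The third summand is nonnegative, so the bound of
    \<open>accuracy_mechanism_le\<close> lies below the stated one.\<close>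
  have "2 * b\<^sup>2 * ln (12 / \<delta>) + 2 * b\<^sup>2 \<le> 2 * b\<^sup>2 * ln (12 / \<delta>) + 2 * b\<^sup>2
      + b\<^sup>2 / 4 * \<delta> * ln (12 / \<delta>) powr (3 / 2)"
    using \<delta> by simp
  then have "accuracy U n (\<lambda>X. result_law kernel_prog [b, \<delta>] (add_noise f (laplace b) X)) f \<le>
      ennreal (sqrt (2 * b\<^sup>2 * ln (12 / \<delta>) + 2 * b\<^sup>2
        + b\<^sup>2 / 4 * \<delta> * ln (12 / \<delta>) powr (3 / 2)))"
    by (intro order_trans[OF accuracy_mechanism_le[OF b \<delta>]] ennreal_leI real_sqrt_le_mono)
  then show "let g = add_noise f (laplace b); h = (\<lambda>X. result_law kernel_prog [b, \<delta>] (g X))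
    in (\<forall>X\<in>databases U n.
          total_variation (h X) (add_noise f (gaussian (2 * b\<^sup>2 * ln (12 / \<delta>))) X) \<le> \<delta>) \<and>
       differentially_private U n (sensitivity U n f / b) 0 h \<and>
       accuracy U n h f \<le> ennreal (sqrt (2 * b\<^sup>2 * ln (12 / \<delta>) + 2 * b\<^sup>2
         + b\<^sup>2 / 4 * \<delta> * ln (12 / \<delta>) powr (3 / 2)))"
    unfolding Let_def
    using total_variation_mechanism[OF b \<delta>] differentially_private_mechanism[OF b \<delta> fin] by blast
qed

end
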